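(* In generalized non-signalling theory (box world), every bipartite entropy vector $(\hat H(X),\hat H(Y),\hat H(XY))$ (with $X$, $Y$ systems of finitely many boxes and the state any state of $XY$) lies in the closure of the set of entropy vectors $(\hat H(X),\hat H(Y),\hat H(XY))$ of separable states of such bipartite systems.
   Context: Box world (GNST): a box has a finite set of inputs and outputs. A system of boxes has states given by all collections $p(\mathbf{a}|\mathbf{x})\ge0$ (output tuple $\mathbf{a}$, input tuple $\mathbf{x}$) that are normalized ($\sum_{\mathbf{a}}p(\mathbf{a}|\mathbf{x})=1$) and no-signalling (for each box $i$, $\sum_{a_i}p(\mathbf{a}|\mathbf{x})$ is independent of $x_i$); reduced states are obtained by summing out the outputs of the discarded boxes. A state of $XY$ is separable if it has the form $p(\mathbf{a},\mathbf{b}|\mathbf{x},\mathbf{y})=\sum_i w_i\,q_i(\mathbf{a}|\mathbf{x})\,r_i(\mathbf{b}|\mathbf{y})$ with finitely many probability weights $w_i\ge0$, $\sum_i w_i=1$, and states $q_i$ of $X$ and $r_i$ of $Y$. An effect is any linear map from states to $[0,1]$; a measurement is a finite set $\{(r,\mu_r)\}$ of effects summing to the constant map $1$ (all such are allowed). A measurement $N=\{(s,\nu_s)\}$ refines $M=\{(r,\mu_r)\}$ if the outcomes of $N$ can be partitioned into sets $P_r$ with $\mu_r=\sum_{s\in P_r}\nu_s$; the refinement is trivial if $\nu_s\propto\mu_r$ whenever $s\in P_r$; $M$ is maximally informative if it has no non-trivial refinement. The measurement entropy of a system $Z$ in state $\mathbf{p}$ is $\hat H(Z)=\inf_M H_M(Z)$,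 the infimum over maximally informative measurements $M$ on $Z$ of the Shannon entropy (base 2) of the outcome distribution $(\mu_r(\mathbf{p}))_r$. *)

theory Defs
  imports "HOL-Analysis.Analysis"
begin

text \<open>A system of finitely many boxes is a list; entry i = (number of inputs,
  number of outputs) of box i, with inputs {0..<m} and outputs {0..<k}.\<close>
type_synonym boxsys = "(nat \<times> nat) list"

text \<open>A (candidate) state: p a x = p(a|x), output tuple a, input tuple x.\<close>
type_synonym bstate = "nat list \<Rightarrow> nat list \<Rightarrow> real"

definition is_boxsys :: "boxsys \<Rightarrow> bool" where
  "is_boxsys S \<longleftrightarrow> (\<forall>i<length S. 1 \<le> fst (S!i) \<and> 1 \<le> snd (S!i))"

definition valid_in :: "boxsys \<Rightarrow> nat list \<Rightarrow> bool" where
  "valid_in S x \<longleftrightarrow> length x = length S \<and> (\<forall>i<length S. x!i < fst (S!i))"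

definition valid_out :: "boxsys \<Rightarrow> nat list \<Rightarrow> bool" where
  "valid_out S a \<longleftrightarrow> length a = length S \<and> (\<forall>i<length S. a!i < snd (S!i))"

definition ins :: "boxsys \<Rightarrow> nat list set" where
  "ins S = {x. valid_in S x}"

definition outs :: "boxsys \<Rightarrow> nat list set" where
  "outs S = {a. valid_out S a}"

definition is_state :: "boxsys \<Rightarrow> bstate \<Rightarrow> bool" where
  "is_state S p \<longleftrightarrow>
     (\<forall>a x. 0 \<le> p a x) \<and>
     (\<forall>a x. \<not> (valid_out S a \<and> valid_in S x) \<longrightarrow> p a x = 0) \<and>
     (\<forall>x. valid_in S x \<longrightarrow> (\<Sum>a\<in>outs S. p a x) = 1) \<and>
     (\<forall>i<length S. \<forall>a x x'. valid_out S a \<longrightarrow> valid_in S x \<longrightarrow> valid_in S x' \<longrightarrow>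
         (\<forall>j<length S. j \<noteq> i \<longrightarrow> x!j = x'!j) \<longrightarrow>
         (\<Sum>t<snd (S!i). p (a[i := t]) x) = (\<Sum>t<snd (S!i). p (a[i := t]) x'))"

text \<open>Reduced states of a bipartite system XY (system list SX @ SY): sum out
  the outputs of the discarded boxes (by no-signalling the choice of the
  discarded boxes' inputs is irrelevant; we fix input 0).\<close>
definition marg_X :: "boxsys \<Rightarrow> boxsys \<Rightarrow> bstate \<Rightarrow> bstate" where
  "marg_X SX SY p = (\<lambda>a x. if valid_out SX a \<and> valid_in SX x
      then (\<Sum>b\<in>outs SY. p (a @ b) (x @ replicate (length SY) 0)) else 0)"

definition marg_Y :: "boxsys \<Rightarrow> boxsys \<Rightarrow> bstate \<Rightarrow> bstate" where
  "marg_Y SX SY p = (\<lambda>b y. if valid_out SY b \<and> valid_in SY y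
      then (\<Sum>a\<in>outs SX. p (a @ b) (replicate (length SX) 0 @ y)) else 0)"

text \<open>Effects: linear maps from states to [0,1]. An effect is identified by its
  values on states; linearity means it is given on states by a linear
  functional in the coordinates p(a|x).\<close>
definition is_effect :: "boxsys \<Rightarrow> (bstate \<Rightarrow> real) \<Rightarrow> bool" where
  "is_effect S e \<longleftrightarrow>
     (\<exists>c :: nat list \<Rightarrow> nat list \<Rightarrow> real. \<forall>p. is_state S p \<longrightarrow>
         e p = (\<Sum>a\<in>outs S. \<Sum>x\<in>ins S. c a x * p a x)) \<and>
     (\<forall>p. is_state S p \<longrightarrow> 0 \<le> e p \<and> e p \<le> 1)"

definition is_measurement :: "boxsys \<Rightarrow> (bstate \<Rightarrow> real) list \<Rightarrow> bool" where
  "is_measurement S M \<longleftrightarrow> (\<forall>e\<in>set M. is_effect S e) \<and>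
     (\<forall>p. is_state S p \<longrightarrow> (\<Sum>r<length M. (M!r) p) = 1)"

definition refines_via :: "boxsys \<Rightarrow> (bstate \<Rightarrow> real) list \<Rightarrow> (nat \<Rightarrow> nat)
    \<Rightarrow> (bstate \<Rightarrow> real) list \<Rightarrow> bool" where
  "refines_via S N f M \<longleftrightarrow>
     (\<forall>s<length N. f s < length M) \<and>
     (\<forall>r<length M. \<forall>p. is_state S p \<longrightarrow>
        (M!r) p = (\<Sum>s\<in>{s. s < length N \<and> f s = r}. (N!s) p))"

definition trivial_refinement :: "boxsys \<Rightarrow> (bstate \<Rightarrow> real) list \<Rightarrow> (nat \<Rightarrow> nat)
    \<Rightarrow> (bstate \<Rightarrow> real) list \<Rightarrow> bool" where
  "trivial_refinement S N f M \<longleftrightarrow>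
     (\<forall>s<length N. \<exists>c::real. \<forall>p. is_state S p \<longrightarrow> (N!s) p = c * (M!(f s)) p)"

definition max_informative :: "boxsys \<Rightarrow> (bstate \<Rightarrow> real) list \<Rightarrow> bool" where
  "max_informative S M \<longleftrightarrow> is_measurement S M \<and>
     (\<forall>N f. is_measurement S N \<longrightarrow> refines_via S N f M \<longrightarrow> trivial_refinement S N f M)"

definition outcome_entropy :: "(bstate \<Rightarrow> real) list \<Rightarrow> bstate \<Rightarrow> real" where
  "outcome_entropy M p = - (\<Sum>r<length M. (if (M!r) p = 0 then 0
                              else (M!r) p * log 2 ((M!r) p)))"

definition meas_entropy :: "boxsys \<Rightarrow> bstate \<Rightarrow> real" where
  "meas_entropy S p = Inf {outcome_entropy M p | M. max_informative S M}"

definition entropy_vec :: "boxsys \<Rightarrow> boxsys \<Rightarrow> bstate \<Rightarrow> real \<times> real \<times> real" where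
  "entropy_vec SX SY p =
     (meas_entropy SX (marg_X SX SY p), meas_entropy SY (marg_Y SX SY p),
      meas_entropy (SX @ SY) p)"

definition separable :: "boxsys \<Rightarrow> boxsys \<Rightarrow> bstate \<Rightarrow> bool" where
  "separable SX SY p \<longleftrightarrow> is_state (SX @ SY) p \<and>
     (\<exists>n::nat. \<exists>w q r. (\<forall>i<n. 0 \<le> w i \<and> is_state SX (q i) \<and> is_state SY (r i)) \<and>
        (\<Sum>i<n. w i) = (1::real) \<and>
        (\<forall>a b x y. valid_out SX a \<longrightarrow> valid_out SY b \<longrightarrow> valid_in SX x \<longrightarrow> valid_in SY y \<longrightarrow>
           p (a @ b) (x @ y) = (\<Sum>i<n. w i * q i a x * r i b y)))"

definition separable_entropy_vecs :: "(real \<times> real \<times> real) set" where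
  "separable_entropy_vecs = {entropy_vec SX SY p | SX SY p.
      is_boxsys SX \<and> is_boxsys SY \<and> separable SX SY p}"

end

theory Submission
  imports Defs
begin

text \<open>
  By Farkas' lemma the effect cone of a box system is generated by the effects
  \<open>p \<mapsto> p(a|x)\<close>, all of which are extreme; so the maximally informative measurements are
  those with all outcomes proportional to such effects. Products of them are again of this
  kind, whence \<open>H(XY) \<le> H(X) + H(Y)\<close>. Conversely every vector \<open>(\<alpha>, \<beta>, \<gamma>)\<close> with
  \<open>0 \<le> \<gamma> \<le> \<alpha> + \<beta>\<close>, \<open>\<alpha>, \<beta> \<ge> 0\<close> is a limit of vectors of separable states. Write
  \<open>\<gamma> = s + t\<close> with \<open>0 \<le> s \<le> \<alpha>\<close>, \<open>0 \<le> t \<le> \<beta>\<close>. Let \<open>X\<close> and \<open>Y\<close> hold independent classical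
  variables that are nonzero with small probability \<open>\<epsilon>\<close> and have entropies about \<open>s\<close> and \<open>t\<close>,
  and give each of \<open>X\<close> and \<open>Y\<close> a further box with two inputs, one of which has a certain outcome.
  Which one it is depends on whether the classical variable of the other side is nonzero. Locally
  the best guess is wrong with probability \<open>\<epsilon>\<close>, and the number of outcomes can be chosen so
  large that this costs entropy about \<open>\<alpha> - s\<close> and \<open>\<beta> - t\<close>; jointly, reading the classical
  variables first makes these outcomes certain.
\<close>

section \<open>Farkas' lemma and tuples\<close>

text \<open>Here \<open>comb u c v\<close> stands for \<open>u + c v\<close>; no vector space laws are needed. The induction step
  projects onto the kernel of \<open>f k\<close> along a vector at which \<open>g\<close> is negative.\<close>

lemma farkas:
  fixes f :: "'j \<Rightarrow> 'v \<Rightarrow> real" and comb :: "'v \<Rightarrow> real \<Rightarrow> 'v \<Rightarrow> 'v"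
  assumes "finite J"
    and comb: "\<And>u c v. u \<in> V \<Longrightarrow> v \<in> V \<Longrightarrow> comb u c v \<in> V"
    and "\<And>j u c v. j \<in> J \<Longrightarrow> u \<in> V \<Longrightarrow> v \<in> V \<Longrightarrow> f j (comb u c v) = f j u + c * f j v"
    and "\<And>u c v. u \<in> V \<Longrightarrow> v \<in> V \<Longrightarrow> g (comb u c v) = g u + c * g v"
    and "\<And>u. u \<in> V \<Longrightarrow> (\<And>j. j \<in> J \<Longrightarrow> 0 \<le> f j u) \<Longrightarrow> 0 \<le> g u"
  shows "\<exists>l. (\<forall>j\<in>J. 0 \<le> l j) \<and> (\<forall>u\<in>V. g u = (\<Sum>j\<in>J. l j * f j u))"
  using assms(1,3-)
proof (induction J arbitrary: f g rule: finite_induct)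
  case empty
  \<comment> \<open>\<open>comb u (-2) u\<close> stands for \<open>- u\<close>, so \<open>g\<close>
    is nonnegative at a point and at its negative.\<close>
  have "g u = 0" if "u \<in> V" for u
    using empty(3)[of u] empty(3)[of "comb u (-2) u"] empty(2)[of u u "-2"] comb[of u u "-2"] that
    by simp
  then show ?case by simp
next
  case (insert k J)
  show ?case
  proof (cases "\<forall>u\<in>V. (\<forall>j\<in>J. 0 \<le> f j u) \<longrightarrow> 0 \<le> g u")
    \<comment> \<open>The constraints in \<open>J\<close> alone already force \<open>g\<close> to be
      nonnegative, so \<open>k\<close> gets the coefficient 0.\<close>
    case True
    have "\<exists>l. (\<forall>j\<in>J. 0 \<le> l j) \<and> (\<forall>u\<in>V. g u = (\<Sum>j\<in>J. l j * f j u))"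
      by (rule insert.IH) (simp_all add: insert.prems(1,2) True)
    then obtain l where l: "\<forall>j\<in>J. 0 \<le> l j" "\<forall>u\<in>V. g u = (\<Sum>j\<in>J. l j * f j u)"
      by blast
    have "(\<Sum>j\<in>insert k J. (l(k := 0)) j * f j u) = (\<Sum>j\<in>J. l j * f j u)" for u
      using insert.hyps by (auto intro!: sum.cong)
    then show ?thesis
      using l by (intro exI[of _ "l(k := 0)"]) simp
  next
    case False
    then obtain v where v: "v \<in> V" "\<And>j. j \<in> J \<Longrightarrow> 0 \<le> f j v" "g v < 0"
      by (auto simp: not_le)
    have neg: "f k v < 0"
      using insert.prems(3)[OF v(1)] v(2,3) by (metis insert_iff linorder_not_le)
    define d where "d = - f k v"
    have d: "d > 0" using neg by (simp add: d_def)
    \<comment> \<open>\<open>f'\<close> and \<open>g'\<close> are \<open>f\<close> and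
      \<open>g\<close> composed with the projection \<open>u + (f k u / d) v\<close>, whose image
      lies in the kernel of \<open>f k\<close> because \<open>f k v = - d\<close>.\<close>
    define f' where "f' = (\<lambda>j u. f j u + f k u / d * f j v)"
    define g' where "g' = (\<lambda>u. g u + f k u / d * g v)"
    have "\<exists>l. (\<forall>j\<in>J. 0 \<le> l j) \<and> (\<forall>u\<in>V. g' u = (\<Sum>j\<in>J. l j * f' j u))"
    proof (rule insert.IH)
      show "f' j (comb u c w) = f' j u + c * f' j w" if "j \<in> J" "u \<in> V" "w \<in> V" for j u c w
        using insert.prems(1)[of j u w c] insert.prems(1)[of k u w c] that
        by (simp add: f'_def algebra_simps add_divide_distrib)
      show "g' (comb u c w) = g' u + c * g' w" if "u \<in> V" "w \<in> V" for u c w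
        using insert.prems(1)[of k u w c] insert.prems(2)[of u w c] that
        by (simp add: g'_def algebra_simps add_divide_distrib)
      show "0 \<le> g' u" if u: "u \<in> V" "\<And>j. j \<in> J \<Longrightarrow> 0 \<le> f' j u" for u
      proof -
        let ?w = "comb u (f k u / d) v"
        have "f k ?w = 0"
          using insert.prems(1)[of k u v "f k u / d"] u(1) v(1) d by (simp add: d_def)
        moreover have "0 \<le> f j ?w" if "j \<in> J" for j
          using insert.prems(1)[of j u v "f k u / d"] u(1) u(2)[OF that] v(1) that
          by (simp add: f'_def)
        ultimately have "0 \<le> g ?w"
          using insert.prems(3)[OF comb[OF u(1) v(1)]] by (metis insert_iff order.refl)
        then show ?thesis
          using insert.prems(2)[OF u(1) v(1), of "f k u / d"] by (simp add: g'_def)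
      qed
    qed
    then obtain l where l: "\<forall>j\<in>J. 0 \<le> l j" "\<forall>u\<in>V. g' u = (\<Sum>j\<in>J. l j * f' j u)"
      by blast
    \<comment> \<open>Expanding the identity for \<open>g'\<close> and collecting the multiples of
      \<open>f k u\<close> gives this coefficient; it is nonnegative because
      \<open>g v < 0\<close>.\<close>
    define c where "c = ((\<Sum>j\<in>J. l j * f j v) - g v) / d"
    have c: "0 \<le> c"
    proof -
      have "0 \<le> (\<Sum>j\<in>J. l j * f j v)"
        using l(1) v(2) by (intro sum_nonneg) simp
      then show ?thesis
        using v(3) d unfolding c_def by (intro divide_nonneg_pos) simp_all
    qed
    have "g u = (\<Sum>j\<in>insert k J. (l(k := c)) j * f j u)" if "u \<in> V" for u
    proof -
      have "(\<Sum>j\<in>J. (l(k := c)) j * f j u) = (\<Sum>j\<in>J. l j * f j u)"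
        using insert.hyps by (intro sum.cong) auto
      moreover have "(\<Sum>j\<in>J. l j * f' j u)
          = (\<Sum>j\<in>J. l j * f j u) + f k u / d * (\<Sum>j\<in>J. l j * f j v)"
        by (simp add: f'_def algebra_simps sum.distrib sum_distrib_left)
      moreover have "g u + f k u / d * g v = (\<Sum>j\<in>J. l j * f' j u)"
        using l(2) that by (simp add: g'_def)
      moreover have "c * f k u = f k u / d * (\<Sum>j\<in>J. l j * f j v) - f k u / d * g v"
        by (simp add: c_def algebra_simps diff_divide_distrib)
      ultimately show ?thesis
        using insert.hyps by simp
    qed
    then show ?thesis
      using l(1) c by (intro exI[of _ "l(k := c)"]) simp
  qed
qed

section \<open>Input and output tuples and sums over them\<close>

lemma valid_out_list_all2: "valid_out S a \<longleftrightarrow> list_all2 (\<lambda>b t. t < snd b) S a"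
  by (auto simp: valid_out_def list_all2_conv_all_nth)

lemma valid_in_list_all2: "valid_in S x \<longleftrightarrow> list_all2 (\<lambda>b t. t < fst b) S x"
  by (auto simp: valid_in_def list_all2_conv_all_nth)

lemma outs_Nil: "outs [] = {[]}" and ins_Nil: "ins [] = {[]}"
  by (auto simp: outs_def ins_def valid_out_def valid_in_def)

lemma outs_Cons: "outs (b # S) = (\<lambda>(t, a). t # a) ` ({..<snd b} \<times> outs S)"
  by (auto simp: outs_def valid_out_list_all2 list_all2_Cons1)

lemma ins_Cons: "ins (b # S) = (\<lambda>(t, a). t # a) ` ({..<fst b} \<times> ins S)"
  by (auto simp: ins_def valid_in_list_all2 list_all2_Cons1)

lemma finite_outs [simp]: "finite (outs S)"
  by (induction S) (auto simp: outs_Nil outs_Cons)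

lemma finite_ins [simp]: "finite (ins S)"
  by (induction S) (auto simp: ins_Nil ins_Cons)

lemma sum_outs_Cons: "(\<Sum>a\<in>outs (b # S). F a) = (\<Sum>t<snd b. \<Sum>a\<in>outs S. F (t # a))"
  by (simp add: outs_Cons sum.reindex inj_on_def sum.cartesian_product case_prod_unfold)

lemma sum_outs_append:
  "(\<Sum>c\<in>outs (S @ T). F c) = (\<Sum>a\<in>outs S. \<Sum>b\<in>outs T. F (a @ b))"
  by (induction S arbitrary: F) (simp_all add: outs_Nil sum_outs_Cons)

lemma list_all2_append_right:
  assumes "length b = length T"
  shows "list_all2 P (S @ T) (a @ b) \<longleftrightarrow> list_all2 P S a \<and> list_all2 P T b"
proof (cases "length a = length S")
  case True
  then show ?thesis by (simp add: list_all2_append)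
next
  case False
  then show ?thesis using assms by (auto dest: list_all2_lengthD)
qed

lemma list_all2_take_drop:
  "list_all2 P (S @ T) a \<longleftrightarrow>
     list_all2 P S (take (length S) a) \<and> list_all2 P T (drop (length S) a)"
proof (cases "length S \<le> length a")
  case True
  then have "list_all2 P (S @ T) (take (length S) a @ drop (length S) a) \<longleftrightarrow>
     list_all2 P S (take (length S) a) \<and> list_all2 P T (drop (length S) a)"
    by (intro list_all2_append) simp
  then show ?thesis by simp
next
  case False
  then show ?thesis by (auto dest: list_all2_lengthD)
qed

lemma valid_out_append:
  "length b = length T \<Longrightarrow> valid_out (S @ T) (a @ b) \<longleftrightarrow> valid_out S a \<and> valid_out T b"
  by (simp add: valid_out_list_all2 list_all2_append_right)

lemma valid_in_append:
  "length y = length T \<Longrightarrow> valid_in (S @ T) (x @ y) \<longleftrightarrow> valid_in S x \<and> valid_in T y"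
  by (simp add: valid_in_list_all2 list_all2_append_right)

lemma valid_out_append':
  "length a = length S \<Longrightarrow> valid_out (S @ T) (a @ b) \<longleftrightarrow> valid_out S a \<and> valid_out T b"
  by (simp add: valid_out_list_all2 list_all2_append)

lemma valid_in_append':
  "length x = length S \<Longrightarrow> valid_in (S @ T) (x @ y) \<longleftrightarrow> valid_in S x \<and> valid_in T y"
  by (simp add: valid_in_list_all2 list_all2_append)

lemma valid_out_take_drop:
  "valid_out (S @ T) a \<longleftrightarrow> valid_out S (take (length S) a) \<and> valid_out T (drop (length S) a)"
  by (simp only: valid_out_list_all2 list_all2_take_drop)

lemma valid_in_take_drop:
  "valid_in (S @ T) x \<longleftrightarrow> valid_in S (take (length S) x) \<and> valid_in T (drop (length S) x)"
  by (simp only: valid_in_list_all2 list_all2_take_drop)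

lemma is_boxsys_append: "is_boxsys (S @ T) \<longleftrightarrow> is_boxsys S \<and> is_boxsys T"
proof -
  have "is_boxsys S \<longleftrightarrow> (\<forall>b\<in>set S. 1 \<le> fst b \<and> 1 \<le> snd b)" for S
    unfolding is_boxsys_def by (metis in_set_conv_nth)
  then show ?thesis by auto
qed

lemma valid_in_zeros [simp]: "is_boxsys S \<Longrightarrow> valid_in S (replicate (length S) 0)"
  by (auto simp: is_boxsys_def valid_in_def Suc_le_eq)

lemma valid_out_zeros [simp]: "is_boxsys S \<Longrightarrow> valid_out S (replicate (length S) 0)"
  by (auto simp: is_boxsys_def valid_out_def Suc_le_eq)

lemma valid_out_update:
  "valid_out S a \<Longrightarrow> i < length S \<Longrightarrow> t < snd (S ! i) \<Longrightarrow> valid_out S (a[i := t])"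
  by (auto simp: valid_out_def nth_list_update)

text \<open>Exchanging \<open>t\<close> with \<open>a ! i\<close> is an involution on the pairs
  \<open>(a, t)\<close>, so updating coordinate \<open>i\<close> merely permutes the
  summands.\<close>

lemma sum_outs_update:
  assumes i: "i < length S"
  shows "(\<Sum>a\<in>outs S. \<Sum>t<snd (S ! i). F (a[i := t])) = real (snd (S ! i)) * (\<Sum>a\<in>outs S. F a)"
proof -
  let ?U = "outs S \<times> {..<snd (S ! i)}"
  let ?h = "\<lambda>(a, t). (a[i := t], a ! i :: nat)"
  have "(\<Sum>(a, t)\<in>?U. F (a[i := t])) = (\<Sum>(a, t)\<in>?U. F a)"
    by (rule sum.reindex_bij_witness[where i = ?h and j = ?h])
      (use i in \<open>auto simp: outs_def valid_out_def nth_list_update\<close>)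
  then show ?thesis
    by (simp add: sum.cartesian_product[symmetric] sum_distrib_left)
qed

text \<open>Inputs are changed one coordinate at a time.\<close>

lemma inputs_eqI:
  fixes F :: "nat list \<Rightarrow> 'b"
  assumes step: "\<And>i u v. i < length S \<Longrightarrow> i \<in> D \<Longrightarrow> valid_in S u \<Longrightarrow> valid_in S v
      \<Longrightarrow> \<forall>j<length S. j \<noteq> i \<longrightarrow> u ! j = v ! j \<Longrightarrow> F u = F v"
    and x: "valid_in S x" and y: "valid_in S y"
    and D: "\<And>i. i < length S \<Longrightarrow> i \<notin> D \<Longrightarrow> x ! i = y ! i"
  shows "F x = F y"
proof -
  define h where "h k = map (\<lambda>i. if i < k then y ! i else x ! i) [0..<length S]" for k
  have valid: "valid_in S (h k)" for k
    using x y by (auto simp: valid_in_def h_def)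
  have "F (h k) = F (h 0)" if "k \<le> length S" for k
    using that
  proof (induction k)
    case (Suc k)
    have "F (h (Suc k)) = F (h k)"
    proof (cases "k \<in> D")
      case True
      have "\<forall>j<length S. j \<noteq> k \<longrightarrow> h (Suc k) ! j = h k ! j"
        by (auto simp: h_def)
      with True show ?thesis
        using step[of k "h (Suc k)" "h k"] valid Suc.prems by simp
    next
      case False
      then have "h (Suc k) = h k"
        using D[of k] Suc.prems by (auto simp: h_def less_Suc_eq)
      then show ?thesis by simp
    qed
    with Suc show ?case by simp
  qed simp
  moreover have "h 0 = x" "h (length S) = y"
    using x y by (auto simp: h_def valid_in_def intro!: nth_equalityI)
  ultimately show ?thesis by (metis order.refl)
qed

section \<open>The cone of states and its dual\<close>

text \<open>The linear conditions on a state. They define a space closed under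
  \<open>p + c q\<close>, to which \<open>farkas\<close> is applied, with nonnegativity of the
  entries as the constraints.\<close>

definition no_signalling :: "boxsys \<Rightarrow> bstate \<Rightarrow> bool" where
  "no_signalling S p \<longleftrightarrow>
     (\<forall>a x. \<not> (valid_out S a \<and> valid_in S x) \<longrightarrow> p a x = 0) \<and>
     (\<forall>i<length S. \<forall>a x x'. valid_out S a \<longrightarrow> valid_in S x \<longrightarrow> valid_in S x' \<longrightarrow>
         (\<forall>j<length S. j \<noteq> i \<longrightarrow> x!j = x'!j) \<longrightarrow>
         (\<Sum>t<snd (S!i). p (a[i := t]) x) = (\<Sum>t<snd (S!i). p (a[i := t]) x'))"

text \<open>Unnormalized states: slices of bipartite states and the certificates for entropy lower
  bounds are of this kind.\<close>

definition state_cone :: "boxsys \<Rightarrow> bstate \<Rightarrow> bool" where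
  "state_cone S p \<longleftrightarrow> no_signalling S p \<and> (\<forall>a x. 0 \<le> p a x)"

text \<open>Total mass, read off at the all-zero input; by \<open>no_signalling_sum\<close> every
  valid input gives the same value.\<close>

definition weight :: "boxsys \<Rightarrow> bstate \<Rightarrow> real" where
  "weight S p = (\<Sum>a\<in>outs S. p a (replicate (length S) 0))"

lemma no_signallingD:
  assumes "no_signalling S p" "i < length S" "valid_out S a" "valid_in S x" "valid_in S x'"
    and "\<forall>j<length S. j \<noteq> i \<longrightarrow> x!j = x'!j"
  shows "(\<Sum>t<snd (S!i). p (a[i := t]) x) = (\<Sum>t<snd (S!i). p (a[i := t]) x')"
  using assms unfolding no_signalling_def by blast

lemma no_signalling_support:
  "no_signalling S p \<Longrightarrow> \<not> (valid_out S a \<and> valid_in S x) \<Longrightarrow> p a x = 0"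
  unfolding no_signalling_def by blast

lemma no_signallingI:
  assumes "\<And>a x. \<not> (valid_out S a \<and> valid_in S x) \<Longrightarrow> p a x = 0"
    and "\<And>i a x x'. i < length S \<Longrightarrow> valid_out S a \<Longrightarrow> valid_in S x \<Longrightarrow> valid_in S x' \<Longrightarrow>
      \<forall>j<length S. j \<noteq> i \<longrightarrow> x!j = x'!j \<Longrightarrow>
      (\<Sum>t<snd (S!i). p (a[i := t]) x) = (\<Sum>t<snd (S!i). p (a[i := t]) x')"
  shows "no_signalling S p"
  unfolding no_signalling_def using assms by blast

text \<open>Summing the no-signalling condition of box \<open>i\<close> over all \<open>a\<close>
  counts every output tuple \<open>snd (S ! i)\<close> times; this positive factor cancels, so
  changing one input at a time keeps the total.\<close>

lemma no_signalling_sum: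
  assumes "no_signalling S p" "is_boxsys S" "valid_in S x"
  shows "(\<Sum>a\<in>outs S. p a x) = weight S p"
  unfolding weight_def
proof (rule inputs_eqI[where S = S and D = UNIV])
  fix i u v
  assume i: "i < length S" and uv: "valid_in S u" "valid_in S v"
    "\<forall>j<length S. j \<noteq> i \<longrightarrow> u ! j = v ! j"
  have "(\<Sum>a\<in>outs S. \<Sum>t<snd (S!i). p (a[i := t]) u)
      = (\<Sum>a\<in>outs S. \<Sum>t<snd (S!i). p (a[i := t]) v)"
    by (intro sum.cong refl no_signallingD[OF assms(1) i _ uv]) (simp add: outs_def)
  moreover have "snd (S ! i) > 0"
    using assms(2) i by (auto simp: is_boxsys_def Suc_le_eq)
  ultimately show "(\<Sum>a\<in>outs S. p a u) = (\<Sum>a\<in>outs S. p a v)"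
    using sum_outs_update[OF i, of "\<lambda>a. p a u"] sum_outs_update[OF i, of "\<lambda>a. p a v"] by simp
qed (use assms in auto)

lemma is_state_altdef:
  "is_state S p \<longleftrightarrow> state_cone S p \<and> (\<forall>x. valid_in S x \<longrightarrow> (\<Sum>a\<in>outs S. p a x) = 1)"
  unfolding is_state_def state_cone_def no_signalling_def by (rule iffI; elim conjE; intro conjI; assumption)

lemma is_state_iff:
  assumes "is_boxsys S"
  shows "is_state S p \<longleftrightarrow> state_cone S p \<and> weight S p = 1"
proof
  assume p: "is_state S p"
  then have "weight S p = 1"
    using assms by (simp add: is_state_altdef weight_def)
  with p show "state_cone S p \<and> weight S p = 1"
    by (simp add: is_state_altdef)
next
  assume p: "state_cone S p \<and> weight S p = 1"
  then have "(\<Sum>a\<in>outs S. p a x) = 1" if "valid_in S x" for x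
    using no_signalling_sum[OF _ assms that] by (simp add: state_cone_def)
  with p show "is_state S p"
    by (simp add: is_state_altdef)
qed

lemma no_signalling_add_scaled:
  assumes "no_signalling S p" "no_signalling S q"
  shows "no_signalling S (\<lambda>a x. p a x + c * q a x)"
proof (rule no_signallingI)
  fix i a x x'
  assume *: "i < length S" "valid_out S a" "valid_in S x" "valid_in S x'"
    "\<forall>j<length S. j \<noteq> i \<longrightarrow> x!j = x'!j"
  show "(\<Sum>t<snd (S!i). p (a[i := t]) x + c * q (a[i := t]) x)
      = (\<Sum>t<snd (S!i). p (a[i := t]) x' + c * q (a[i := t]) x')"
    using no_signallingD[OF assms(1) *] no_signallingD[OF assms(2) *]
    by (simp add: sum.distrib flip: sum_distrib_left)
qed (simp add: assms[THEN no_signalling_support])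

lemma no_signalling_zero: "no_signalling S (\<lambda>a x. 0)"
  by (rule no_signallingI) simp_all

lemma state_cone_scale:
  "state_cone S p \<Longrightarrow> 0 \<le> c \<Longrightarrow> state_cone S (\<lambda>a x. c * p a x)"
  using no_signalling_add_scaled[OF no_signalling_zero, of S p c] by (simp add: state_cone_def)

lemma state_cone_add:
  "state_cone S p \<Longrightarrow> state_cone S q \<Longrightarrow> state_cone S (\<lambda>a x. p a x + q a x)"
  using no_signalling_add_scaled[of S p q 1] by (simp add: state_cone_def)

lemma state_cone_sum:
  "(\<And>i. i \<in> I \<Longrightarrow> state_cone S (p i)) \<Longrightarrow> state_cone S (\<lambda>a x. \<Sum>i\<in>I. p i a x)"
  by (induction I rule: infinite_finite_induct)
    (simp_all add: state_cone_def[of S "\<lambda>_ _. 0"] no_signalling_zero state_cone_add)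

lemma weight_sum: "weight S (\<lambda>a x. \<Sum>i\<in>I. p i a x) = (\<Sum>i\<in>I. weight S (p i))"
  unfolding weight_def by (rule sum.swap)

lemma weight_scale: "weight S (\<lambda>a x. c * p a x) = c * weight S p"
  by (simp add: weight_def sum_distrib_left)

lemma weight_nonneg: "state_cone S p \<Longrightarrow> 0 \<le> weight S p"
  by (simp add: weight_def state_cone_def sum_nonneg)

lemma state_cone_le_weight:
  assumes "state_cone S p" "is_boxsys S"
  shows "p a x \<le> weight S p"
proof (cases "valid_out S a \<and> valid_in S x")
  case True
  then have "a \<in> outs S" by (simp add: outs_def)
  then have "p a x \<le> (\<Sum>a\<in>outs S. p a x)"
    using assms by (intro member_le_sum) (auto simp: state_cone_def)
  then show ?thesis
    using no_signalling_sum[of S p x] True assms by (simp add: state_cone_def)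
next
  case False
  then show ?thesis
    using assms weight_nonneg[of S p] no_signalling_support[of S p a x]
    by (simp add: state_cone_def)
qed

lemma state_nonneg: "is_state S p \<Longrightarrow> 0 \<le> p a x"
  by (simp add: is_state_altdef state_cone_def)

text \<open>Entries are bounded by the weight, so weight 0 forces the zero function and any other
  weight can be divided out. Homogeneous facts pass from states to the cone in this way.\<close>

lemma state_cone_cases:
  assumes "state_cone S p" "is_boxsys S"
  obtains "\<And>a x. p a x = 0" "weight S p = 0"
  | q where "is_state S q" "weight S p > 0" "\<And>a x. p a x = weight S p * q a x"
proof (cases "weight S p = 0")
  case True
  then have "p a x = 0" for a x
    using state_cone_le_weight[OF assms, of a x] assms by (simp add: state_cone_def order.antisym)
  with True show ?thesis using that(1) by blast
next
  case False
  then have pos: "weight S p > 0"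
    using weight_nonneg[OF assms(1)] by simp
  let ?q = "\<lambda>a x. inverse (weight S p) * p a x"
  have "is_state S ?q"
    unfolding is_state_iff[OF assms(2)] weight_scale
    using pos state_cone_scale[OF assms(1), of "inverse (weight S p)"] by simp
  then show ?thesis
    using that(2)[of ?q] pos by simp
qed

section \<open>Deterministic states and the extreme rays of the effect cone\<close>

definition deterministic :: "boxsys \<Rightarrow> (nat \<Rightarrow> nat \<Rightarrow> nat) \<Rightarrow> bstate" where
  "deterministic S g = (\<lambda>a x. of_bool (valid_out S a \<and> valid_in S x \<and>
     (\<forall>i<length S. a ! i = g i (x ! i))))"

text \<open>In the sum over the output of box \<open>i\<close> only the term
  \<open>t = g i (x ! i)\<close> can survive, and whether it does depends on the other boxes alone;
  hence no signalling.\<close>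

lemma is_state_deterministic:
  assumes g: "\<And>i t. i < length S \<Longrightarrow> t < fst (S ! i) \<Longrightarrow> g i t < snd (S ! i)"
  shows "is_state S (deterministic S g)"
proof -
  have "(\<Sum>a\<in>outs S. deterministic S g a x) = 1" if x: "valid_in S x" for x
  proof -
    define b where "b = map (\<lambda>i. g i (x ! i)) [0..<length S]"
    have b: "b \<in> outs S"
      using x g by (auto simp: outs_def valid_out_def valid_in_def b_def)
    have "deterministic S g a x = (if a = b then 1 else 0)" if "a \<in> outs S" for a
      using that x by (auto simp: deterministic_def outs_def valid_out_def b_def intro: nth_equalityI)
    then show ?thesis using b by simp
  qed
  moreover
  have "(\<Sum>t<snd (S!i). deterministic S g (a[i := t]) x)
      = (\<Sum>t<snd (S!i). deterministic S g (a[i := t]) x')"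
    if i: "i < length S" and a: "valid_out S a" and x: "valid_in S x" "valid_in S x'"
      and eq: "\<forall>j<length S. j \<noteq> i \<longrightarrow> x!j = x'!j" for i a x x'
  proof -
    have *: "(\<Sum>t<snd (S!i). deterministic S g (a[i := t]) y)
        = of_bool (\<forall>j<length S. j \<noteq> i \<longrightarrow> a ! j = g j (y ! j))" if y: "valid_in S y" for y
    proof -
      have "deterministic S g (a[i := t]) y
          = (if t = g i (y ! i) then of_bool (\<forall>j<length S. j \<noteq> i \<longrightarrow> a ! j = g j (y ! j)) else 0)"
        if "t < snd (S ! i)" for t
      proof -
        have "i < length a" using a i by (simp add: valid_out_def)
        then have "(\<forall>j<length S. a[i := t] ! j = g j (y ! j)) \<longleftrightarrow>
            t = g i (y ! i) \<and> (\<forall>j<length S. j \<noteq> i \<longrightarrow> a ! j = g j (y ! j))"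
          using i by (metis nth_list_update_eq nth_list_update_neq)
        then show ?thesis
          unfolding deterministic_def using valid_out_update[OF a i that] y by simp
      qed
      then have "(\<Sum>t<snd (S!i). deterministic S g (a[i := t]) y) = (\<Sum>t<snd (S!i).
          if t = g i (y ! i) then of_bool (\<forall>j<length S. j \<noteq> i \<longrightarrow> a ! j = g j (y ! j)) else 0)"
        by (intro sum.cong) auto
      moreover have "g i (y ! i) < snd (S ! i)"
        using g i y by (simp add: valid_in_def)
      ultimately show ?thesis by simp
    qed
    have "(\<forall>j<length S. j \<noteq> i \<longrightarrow> a ! j = g j (x ! j)) \<longleftrightarrow>
        (\<forall>j<length S. j \<noteq> i \<longrightarrow> a ! j = g j (x' ! j))"
      using eq by metis
    then show ?thesis
      by (simp only: *[OF x(1)] *[OF x(2)])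
  qed
  then have "no_signalling S (deterministic S g)"
    by (rule no_signallingI[rotated]) (auto simp: deterministic_def)
  moreover have "\<forall>a x. 0 \<le> deterministic S g a x"
    by (simp add: deterministic_def)
  ultimately show ?thesis
    by (simp add: is_state_altdef state_cone_def)
qed

text \<open>Box \<open>i\<close> answers \<open>a ! i\<close> on input \<open>x ! i\<close> and, on
  every other input, some \<open>t\<close> different from \<open>a' ! i\<close>; two outputs leave
  room for such a \<open>t\<close>. If \<open>x' ! i = x ! i\<close>, then \<open>a ! i\<close>
  itself differs from \<open>a' ! i\<close>.\<close>

lemma deterministic_state_avoiding:
  assumes "is_boxsys S" "valid_out S a" "valid_in S x"
    and i: "i < length S" "snd (S ! i) \<ge> 2" and neq: "a ! i \<noteq> a' ! i \<or> x ! i \<noteq> x' ! i"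
  obtains p where "is_state S p" "p a x = 1" "p a' x' = 0"
proof -
  define t :: nat where "t = of_bool (a' ! i = 0)"
  have t: "t < snd (S ! i)" "t \<noteq> a' ! i"
    using i(2) by (auto simp: t_def)
  define g where "g = (\<lambda>j u. if u = x ! j then a ! j else if j = i then t else 0)"
  have "is_state S (deterministic S g)"
    using assms(1,2) t(1)
    by (intro is_state_deterministic) (simp add: g_def valid_out_def is_boxsys_def Suc_le_eq)
  moreover have "deterministic S g a x = 1"
    using assms(2,3) by (simp add: deterministic_def g_def)
  moreover have "deterministic S g a' x' = 0"
  proof -
    have "a' ! i \<noteq> g i (x' ! i)"
      using neq t(2) by (auto simp: g_def)
    then show ?thesis
      using i(1) unfolding deterministic_def by (simp only: of_bool_eq_0_iff) blast
  qed
  ultimately show ?thesis using that by blast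
qed

lemma state_attaining_1:
  assumes "is_boxsys S" "valid_out S a" "valid_in S x"
  obtains p where "is_state S p" "p a x = 1"
proof -
  have "is_state S (deterministic S (\<lambda>i _. a ! i))"
    using assms by (intro is_state_deterministic) (simp add: valid_out_def)
  moreover have "deterministic S (\<lambda>i _. a ! i) a x = 1"
    using assms by (simp add: deterministic_def)
  ultimately show ?thesis using that by blast
qed

text \<open>Coordinates in which \<open>(a, x)\<close> and \<open>(a', x')\<close> differ belong to boxes with a single
  output, whose input does not matter.\<close>

lemma fiducial_effect_extreme:
  assumes S: "is_boxsys S" and ax: "valid_out S a" "valid_in S x"
    and ax': "valid_out S a'" "valid_in S x'"
    and le: "\<And>p. is_state S p \<Longrightarrow> p a x \<le> c * p a' x'"
    and p: "is_state S p"
  shows "p a x = p a' x'"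
proof -
  \<comment> \<open>Otherwise a deterministic state has value 1 at \<open>(a, x)\<close> and 0 at
    \<open>(a', x')\<close>, against \<open>le\<close>.\<close>
  have same: "a ! i = a' ! i \<and> x ! i = x' ! i" if i: "i < length S" "snd (S ! i) \<ge> 2" for i
  proof (rule ccontr)
    assume "\<not> ?thesis"
    then obtain q where "is_state S q" "q a x = 1" "q a' x' = 0"
      using deterministic_state_avoiding[OF S ax i, of a' x'] by blast
    then show False using le[of q] by simp
  qed
  define D where "D = {i. snd (S ! i) = 1}"
  have D: "snd (S ! i) \<ge> 2" if "i < length S" "i \<notin> D" for i
    using S that by (simp add: D_def is_boxsys_def) (metis One_nat_def Suc_1 Suc_leI le_neq_implies_less)
  have "a ! i = a' ! i" if i: "i < length S" for i
  proof (cases "i \<in> D")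
    case True
    then have "snd (S ! i) = 1" by (simp add: D_def)
    moreover have "a ! i < snd (S ! i)" "a' ! i < snd (S ! i)"
      using ax(1) ax'(1) i by (simp_all add: valid_out_def)
    ultimately show ?thesis by simp
  qed (use same D i in blast)
  then have a: "a = a'"
    using ax(1) ax'(1) by (intro nth_equalityI) (simp_all add: valid_out_def)
  have "p a x = p a x'"
  proof (rule inputs_eqI[where S = S and D = D])
    fix i u v
    assume i: "i < length S" "i \<in> D" and uv: "valid_in S u" "valid_in S v"
      "\<forall>j<length S. j \<noteq> i \<longrightarrow> u ! j = v ! j"
    have "snd (S ! i) = 1"
      using i(2) by (simp add: D_def)
    moreover have "a ! i < snd (S ! i)"
      using i(1) ax(1) unfolding valid_out_def by blast
    ultimately have "a ! i < 1" "snd (S ! i) = 1"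
      by simp_all
    then have "a[i := 0] = a"
      by (metis less_one list_update_id)
    \<comment> \<open>With a single output the no-signalling sum of box \<open>i\<close> reduces to
      its term \<open>t = 0\<close>.\<close>
    moreover have "(\<Sum>t<snd (S!i). p (a[i := t]) u) = (\<Sum>t<snd (S!i). p (a[i := t]) v)"
      using p S i uv ax(1) by (intro no_signallingD[of S p]) (auto simp: is_state_iff state_cone_def)
    ultimately show "p a u = p a v"
      using \<open>snd (S ! i) = 1\<close> by simp
  next
    show "x ! i = x' ! i" if "i < length S" "i \<notin> D" for i
      using same D that by blast
  qed (fact ax(2) ax'(2))+
  with a show ?thesis by simp
qed

text \<open>Farkas' lemma on the space of no-signalling functions, with the entries
  \<open>p a x\<close> as constraints: the functional that represents \<open>e\<close> is
  nonnegative on states, hence on the whole cone.\<close>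

lemma effect_fiducial_decomposition:
  assumes S: "is_boxsys S" and e: "is_effect S e"
  obtains l where "\<And>a x. 0 \<le> l a x"
    "\<And>p. is_state S p \<Longrightarrow> e p = (\<Sum>(a, x)\<in>outs S \<times> ins S. l a x * p a x)"
proof -
  obtain c where c: "\<And>p. is_state S p \<Longrightarrow> e p = (\<Sum>a\<in>outs S. \<Sum>x\<in>ins S. c a x * p a x)"
    using e unfolding is_effect_def by blast
  define g where "g p = (\<Sum>a\<in>outs S. \<Sum>x\<in>ins S. c a x * p a x)" for p :: bstate
  let ?f = "\<lambda>(a, x) p. p a x :: real"
  have "\<exists>l. (\<forall>j\<in>outs S \<times> ins S. 0 \<le> l j) \<and>
      (\<forall>p\<in>Collect (no_signalling S). g p = (\<Sum>j\<in>outs S \<times> ins S. l j * ?f j p))"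
  proof (rule farkas[where comb = "\<lambda>p c q a x. p a x + c * q a x"])
    show "g (\<lambda>a x. p a x + c * q a x) = g p + c * g q" for p c q
      by (simp add: g_def algebra_simps sum.distrib sum_distrib_left)
    show "0 \<le> g p" if p: "p \<in> Collect (no_signalling S)" "\<And>j. j \<in> outs S \<times> ins S \<Longrightarrow> 0 \<le> ?f j p" for p
    proof -
      have "0 \<le> p a x" for a x
      proof (cases "valid_out S a \<and> valid_in S x")
        case True
        then show ?thesis using p(2)[of "(a, x)"] by (simp add: outs_def ins_def)
      next
        case False
        then show ?thesis using p(1) by (simp add: no_signalling_support)
      qed
      with p(1) have "state_cone S p" by (simp add: state_cone_def)
      from state_cone_cases[OF this S] consider "\<And>a x. p a x = 0"
        | q w where "is_state S q" "w > 0" "\<And>a x. p a x = w * q a x"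
        by blast
      then show ?thesis
      proof cases
        case 1
        then show ?thesis unfolding g_def by simp
      next
        case (2 q w)
        have "g p = w * g q"
          unfolding g_def 2(3) by (simp add: sum_distrib_left ac_simps)
        moreover have "0 \<le> e q"
          using e 2(1) by (simp add: is_effect_def)
        then have "0 \<le> g q"
          using c[OF 2(1)] by (simp add: g_def)
        ultimately show ?thesis using 2(2) by simp
      qed
    qed
  qed (simp_all add: no_signalling_add_scaled case_prod_unfold)
  then obtain l where l: "\<forall>j\<in>outs S \<times> ins S. 0 \<le> l j"
    "\<forall>p\<in>Collect (no_signalling S). g p = (\<Sum>j\<in>outs S \<times> ins S. l j * ?f j p)"
    by blast
  \<comment> \<open>\<open>farkas\<close> controls the sign of \<open>l\<close> only on
    \<open>outs S \<times> ins S\<close>; extending by 0 gives nonnegativity everywhere.\<close>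
  define l' where "l' a x = (if (a, x) \<in> outs S \<times> ins S then l (a, x) else 0)" for a x
  show ?thesis
  proof (rule that[of l'])
    show "0 \<le> l' a x" for a x
      using l(1) by (auto simp: l'_def)
    show "e p = (\<Sum>(a, x)\<in>outs S \<times> ins S. l' a x * p a x)" if p: "is_state S p" for p
    proof -
      have "no_signalling S p"
        using p S by (simp add: is_state_iff state_cone_def)
      then have "e p = (\<Sum>j\<in>outs S \<times> ins S. l j * ?f j p)"
        using l(2) c[OF p] by (simp add: g_def)
      also have "\<dots> = (\<Sum>(a, x)\<in>outs S \<times> ins S. l' a x * p a x)"
        by (intro sum.cong) (auto simp: l'_def)
      finally show ?thesis .
    qed
  qed
qed

section \<open>Maximally informative measurements\<close>

text \<open>The Shannon summand. Its factor \<open>t\<close> makes it vanish at 0, in accordance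
  with the case distinction in \<open>outcome_entropy\<close>.\<close>

definition eta :: "real \<Rightarrow> real" where
  "eta t = - t * log 2 t"

lemma eta_0 [simp]: "eta 0 = 0" and eta_1 [simp]: "eta 1 = 0"
  by (simp_all add: eta_def)

lemma eta_nonneg: "0 \<le> t \<Longrightarrow> t \<le> 1 \<Longrightarrow> 0 \<le> eta t"
  by (cases "t = 0") (auto simp: eta_def mult_le_0_iff)

lemma eta_mult:
  assumes "0 \<le> s" "0 \<le> t"
  shows "eta (s * t) = t * eta s + s * eta t"
  using assms by (cases "s = 0 \<or> t = 0") (auto simp: eta_def log_mult algebra_simps)

lemma outcome_entropy_eta: "outcome_entropy M p = (\<Sum>r<length M. eta ((M!r) p))"
  unfolding outcome_entropy_def sum_negf[symmetric] eta_def by (intro sum.cong) auto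

lemma sum_nth_distinct:
  "distinct xs \<Longrightarrow> (\<Sum>r<length xs. F (xs ! r)) = (\<Sum>i\<in>set xs. F i)"
  by (rule sum.reindex_bij_betw[OF bij_betw_nth]) auto

text \<open>Normal form of the maximally informative measurements: outcome \<open>i\<close> has
  probability \<open>C i * p (A i) (X i)\<close>. The index set is arbitrary, so that products
  \<open>I \<times> J\<close> and \<open>outs S\<close> can serve directly.\<close>

definition fiducial_measurement ::
    "boxsys \<Rightarrow> 'i set \<Rightarrow> ('i \<Rightarrow> real) \<Rightarrow> ('i \<Rightarrow> nat list) \<Rightarrow> ('i \<Rightarrow> nat list) \<Rightarrow> bool" where
  "fiducial_measurement S I C A X \<longleftrightarrow> finite I \<and>
     (\<forall>i\<in>I. 0 \<le> C i \<and> valid_out S (A i) \<and> valid_in S (X i)) \<and>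
     (\<forall>p. is_state S p \<longrightarrow> (\<Sum>i\<in>I. C i * p (A i) (X i)) = 1)"

lemma fiducial_measurement_term_le_1:
  assumes "fiducial_measurement S I C A X" "i \<in> I" "is_state S p"
  shows "C i * p (A i) (X i) \<le> 1"
proof -
  have "C i * p (A i) (X i) \<le> (\<Sum>i\<in>I. C i * p (A i) (X i))"
    using assms by (intro member_le_sum) (auto simp: fiducial_measurement_def state_nonneg)
  also have "\<dots> = 1"
    using assms by (simp add: fiducial_measurement_def)
  finally show ?thesis .
qed

text \<open>Some state gives the output \<open>A i\<close> on input \<open>X i\<close> with
  certainty, so \<open>C i\<close> is itself an outcome probability.\<close>

lemma fiducial_measurement_coeff_le_1:
  assumes "fiducial_measurement S I C A X" "is_boxsys S" "i \<in> I"
  shows "C i \<le> 1"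
proof -
  have "valid_out S (A i)" "valid_in S (X i)"
    using assms by (auto simp: fiducial_measurement_def)
  then obtain p where "is_state S p" "p (A i) (X i) = 1"
    using state_attaining_1[OF assms(2)] by blast
  then show ?thesis
    using fiducial_measurement_term_le_1[OF assms(1,3), of p] by simp
qed

text \<open>Normalization extends to the cone by homogeneity. Thus the value of a certificate does
  not depend on the measurement.\<close>

lemma fiducial_measurement_weight:
  assumes M: "fiducial_measurement S I C A X" and S: "is_boxsys S" and q: "state_cone S q"
  shows "(\<Sum>i\<in>I. C i * q (A i) (X i)) = weight S q"
  using q S
proof (cases rule: state_cone_cases)
  case (2 p)
  have "(\<Sum>i\<in>I. C i * q (A i) (X i)) = weight S q * (\<Sum>i\<in>I. C i * p (A i) (X i))"
    by (simp add: 2(3) sum_distrib_left ac_simps)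
  then show ?thesis
    using M 2(1) by (simp add: fiducial_measurement_def)
qed simp

lemma is_effect_fiducial:
  assumes "valid_out S a" "valid_in S x"
    and le: "\<And>p. is_state S p \<Longrightarrow> 0 \<le> c * p a x \<and> c * p a x \<le> 1"
  shows "is_effect S (\<lambda>p. c * p a x)"
proof -
  have "c * p a x = (\<Sum>b\<in>outs S. \<Sum>y\<in>ins S. (if b = a then if y = x then c else 0 else 0) * p b y)" for p
  proof -
    have "(\<Sum>y\<in>ins S. (if b = a then if y = x then c else 0 else 0) * p b y)
        = (if b = a then \<Sum>y\<in>ins S. if y = x then c * p a x else 0 else 0)" for b
      by (cases "b = a") (auto intro!: sum.cong simp del: sum.delta sum.delta')
    then show ?thesis
      using assms(1,2) by (simp add: outs_def ins_def finite_outs[unfolded outs_def] finite_ins[unfolded ins_def])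
  qed
  then show ?thesis
    unfolding is_effect_def
    by (intro conjI exI[of _ "\<lambda>b y. if b = a then if y = x then c else 0 else 0"] allI impI)
      (use le in \<open>blast+\<close>)
qed

text \<open>Every term with positive coefficient in the fiducial decomposition of \<open>e\<close>
  is itself dominated by a multiple of \<open>p a x\<close>, so by
  \<open>fiducial_effect_extreme\<close> it coincides with \<open>p a x\<close> up to that
  coefficient.\<close>

lemma is_effect_proportional_fiducial:
  assumes S: "is_boxsys S" and e: "is_effect S e"
    and ax: "valid_out S a" "valid_in S x" and le: "\<And>p. is_state S p \<Longrightarrow> e p \<le> c * p a x"
  obtains k where "\<And>p. is_state S p \<Longrightarrow> e p = k * p a x"
proof -
  obtain l where l: "\<And>a x. 0 \<le> l a x"
    "\<And>p. is_state S p \<Longrightarrow> e p = (\<Sum>(a, x)\<in>outs S \<times> ins S. l a x * p a x)"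
    using effect_fiducial_decomposition[OF S e] by blast
  have eq: "l a' x' * p a' x' = l a' x' * p a x"
    if *: "a' \<in> outs S" "x' \<in> ins S" and p: "is_state S p" for a' x' p
  proof (cases "l a' x' = 0")
    case False
    then have pos: "l a' x' > 0" using l(1)[of a' x'] by simp
    have "q a' x' \<le> c / l a' x' * q a x" if q: "is_state S q" for q
    proof -
      have "(\<lambda>(a, x). l a x * q a x) (a', x') \<le> (\<Sum>(a, x)\<in>outs S \<times> ins S. l a x * q a x)"
        using * l(1) state_nonneg[OF q] by (intro member_le_sum) auto
      then have "l a' x' * q a' x' \<le> c * q a x"
        using le[OF q] l(2)[OF q] by simp
      then show ?thesis using pos by (simp add: field_simps)
    qed
    then have "p a' x' = p a x"
      using * by (intro fiducial_effect_extreme[OF S _ _ ax _ p, where c = "c / l a' x'"]) (auto simp: outs_def ins_def)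
    then show ?thesis by simp
  qed simp
  have "e p = (\<Sum>(a', x')\<in>outs S \<times> ins S. l a' x') * p a x" if p: "is_state S p" for p
    unfolding l(2)[OF p] sum_distrib_right using eq[OF _ _ p] by (intro sum.cong) auto
  then show ?thesis using that by blast
qed

text \<open>An outcome of a refinement is dominated by the outcome it refines. Since that one is a
  multiple of a fiducial effect, extremality makes the two proportional.\<close>

lemma fiducial_measurement_max_informative:
  assumes S: "is_boxsys S" and M: "fiducial_measurement S I C A X"
  obtains L where "max_informative S L"
    "\<And>p. outcome_entropy L p = (\<Sum>i\<in>I. eta (C i * p (A i) (X i)))"
proof -
  have I: "finite I" and valid: "\<And>i. i \<in> I \<Longrightarrow> 0 \<le> C i \<and> valid_out S (A i) \<and> valid_in S (X i)"
    using M by (auto simp: fiducial_measurement_def)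
  obtain xs where xs: "set xs = I" "distinct xs"
    using finite_distinct_list[OF I] by blast
  define L where "L = map (\<lambda>i p. C i * p (A i) (X i)) xs"
  have L: "(\<Sum>r<length L. F ((L ! r) p)) = (\<Sum>i\<in>I. F (C i * p (A i) (X i)))" for F p
    using sum_nth_distinct[OF xs(2), of "\<lambda>i. F (C i * p (A i) (X i))"] xs(1)
    by (simp add: L_def)
  have eff: "is_effect S (\<lambda>p. C i * p (A i) (X i))" if "i \<in> I" for i
    using valid[OF that] fiducial_measurement_term_le_1[OF M that]
    by (intro is_effect_fiducial) (auto simp: state_nonneg)
  have meas: "is_measurement S L"
    unfolding is_measurement_def
  proof (intro conjI allI impI)
    show "\<forall>e\<in>set L. is_effect S e"
      using eff xs(1) by (auto simp: L_def)
    show "(\<Sum>r<length L. (L ! r) p) = 1" if "is_state S p" for p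
      using L[of "\<lambda>t. t" p] M that by (simp add: fiducial_measurement_def)
  qed
  have "max_informative S L"
    unfolding max_informative_def trivial_refinement_def
  proof (intro conjI allI impI meas)
    fix N f s assume N: "is_measurement S N" and ref: "refines_via S N f L" and s: "s < length N"
    define i where "i = xs ! f s"
    have fs: "f s < length L" using ref s by (simp add: refines_via_def)
    then have i: "i \<in> I" "L ! f s = (\<lambda>p. C i * p (A i) (X i))"
      using xs(1) by (auto simp: L_def i_def)
    have eN: "is_effect S (N ! s')" if "s' < length N" for s'
      using N that by (simp add: is_measurement_def)
    have le: "(N ! s) p \<le> C i * p (A i) (X i)" if p: "is_state S p" for p
    proof -
      have "(N ! s) p \<le> (\<Sum>s'\<in>{s'. s' < length N \<and> f s' = f s}. (N!s') p)"
      proof (rule member_le_sum)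
        show "0 \<le> (N ! s') p" if "s' \<in> {s'. s' < length N \<and> f s' = f s} - {s}" for s'
          using eN[of s'] p that unfolding is_effect_def by blast
      qed (use s in auto)
      also have "\<dots> = (L ! f s) p"
        using ref fs p unfolding refines_via_def by simp
      finally show ?thesis by (simp add: i)
    qed
    obtain k where k: "\<And>p. is_state S p \<Longrightarrow> (N ! s) p = k * p (A i) (X i)"
      using is_effect_proportional_fiducial[OF S eN[OF s] _ _ le] valid[OF i(1)] by blast
    show "\<exists>c. \<forall>p. is_state S p \<longrightarrow> (N ! s) p = c * (L ! f s) p"
    proof (cases "C i = 0")
      \<comment> \<open>Dividing by \<open>C i\<close> is impossible here, but the refining outcome
        vanishes on all states.\<close>
      case True
      have "(N ! s) p = 0" if "is_state S p" for p
      proof -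
        have "0 \<le> (N ! s) p" using eN[OF s] that unfolding is_effect_def by blast
        then show ?thesis using le[OF that] True by simp
      qed
      then show ?thesis by (intro exI[of _ 0]) simp
    next
      case False
      then show ?thesis using k by (intro exI[of _ "k / C i"]) (simp add: i)
    qed
  qed
  moreover have "outcome_entropy L p = (\<Sum>i\<in>I. eta (C i * p (A i) (X i)))" for p
    unfolding outcome_entropy_eta by (rule L)
  ultimately show ?thesis using that by blast
qed

text \<open>Splitting each outcome of \<open>M\<close> into the terms of its fiducial decomposition
  is a refinement. Maximality makes it trivial, so each outcome is a multiple of any nonzero term of
  its own decomposition.\<close>

lemma max_informative_fiducial:
  assumes S: "is_boxsys S" and M: "max_informative S M"
  obtains C A X where "fiducial_measurement S {..<length M} C A X"
    "\<And>p. is_state S p \<Longrightarrow> outcome_entropy M p = (\<Sum>r<length M. eta (C r * p (A r) (X r)))"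
proof -
  have eff: "is_effect S (M ! r)" if "r < length M" for r
    using M that by (simp add: max_informative_def is_measurement_def)
  have "\<forall>r\<in>{..<length M}. \<exists>l. (\<forall>a x. 0 \<le> l a x) \<and>
      (\<forall>p. is_state S p \<longrightarrow> (M ! r) p = (\<Sum>(a, x)\<in>outs S \<times> ins S. l a x * p a x))"
  proof
    fix r assume "r \<in> {..<length M}"
    then have r: "r < length M" by simp
    obtain l where l: "\<And>a x. 0 \<le> l a x"
      "\<And>p. is_state S p \<Longrightarrow> (M ! r) p = (\<Sum>(a, x)\<in>outs S \<times> ins S. l a x * p a x)"
      using effect_fiducial_decomposition[OF S eff[OF r]] by blast
    show "\<exists>l. (\<forall>a x. 0 \<le> l a x) \<and>
        (\<forall>p. is_state S p \<longrightarrow> (M ! r) p = (\<Sum>(a, x)\<in>outs S \<times> ins S. l a x * p a x))"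
      by (intro exI[of _ l] conjI allI impI l)
  qed
  from bchoice[OF this] obtain l where
    lall: "\<forall>r\<in>{..<length M}. (\<forall>a x. 0 \<le> l r a x) \<and>
      (\<forall>p. is_state S p \<longrightarrow> (M ! r) p = (\<Sum>(a, x)\<in>outs S \<times> ins S. l r a x * p a x))"
    by (elim exE)
  have l: "0 \<le> l r a x" if "r < length M" for r a x
    using lall that by blast
  have l': "(M ! r) p = (\<Sum>(a, x)\<in>outs S \<times> ins S. l r a x * p a x)"
    if "r < length M" "is_state S p" for r p
    using lall that by blast
  define U where "U = outs S \<times> ins S"
  have U: "finite U" by (simp add: U_def)
  obtain xs where xs: "set xs = {..<length M} \<times> U" "distinct xs"
    using finite_distinct_list[of "{..<length M} \<times> U"] U by auto
  \<comment> \<open>The refining measurement has one outcome per triple \<open>(r, a, x)\<close>;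
    \<open>f\<close> below will recover \<open>r\<close>.\<close>
  define N where "N = map (\<lambda>(r, a, x) p. l r a x * p a x :: real) xs"
  have len: "length N = length xs" by (simp add: N_def)
  have le: "l r a x * p a x \<le> (M ! r) p"
    if "r < length M" "(a, x) \<in> U" "is_state S p" for r a x p
  proof -
    have "(\<lambda>(a, x). l r a x * p a x) (a, x) \<le> (\<Sum>(a, x)\<in>U. l r a x * p a x)"
      using that U l by (intro member_le_sum) (auto simp: state_nonneg)
    then show ?thesis using l'[of r p] that by (simp add: U_def)
  qed
  have meas: "is_measurement S N"
    unfolding is_measurement_def
  proof (intro conjI allI impI ballI)
    fix e assume "e \<in> set N"
    then obtain r a x where e: "e = (\<lambda>p. l r a x * p a x)" and r: "r < length M" and ax: "(a, x) \<in> U"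
      using xs(1) by (auto simp: N_def)
    have "l r a x * p a x \<le> 1" if "is_state S p" for p
      using le[OF r ax that] eff[OF r] that by (force simp: is_effect_def)
    then show "is_effect S e"
      unfolding e using ax l[OF r]
      by (intro is_effect_fiducial) (auto simp: state_nonneg U_def outs_def ins_def)
  next
    fix p assume p: "is_state S p"
    have "(\<Sum>s<length N. (N ! s) p) = (\<Sum>s<length xs. (\<lambda>(r, a, x). l r a x * p a x) (xs ! s))"
      by (intro sum.cong) (auto simp: N_def case_prod_unfold)
    also have "\<dots> = (\<Sum>(r, a, x)\<in>{..<length M} \<times> U. l r a x * p a x)"
      by (simp only: sum_nth_distinct[OF xs(2)] xs(1))
    also have "\<dots> = (\<Sum>r<length M. \<Sum>(a, x)\<in>U. l r a x * p a x)"
      by (rule sum.cartesian_product[symmetric])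
    also have "\<dots> = (\<Sum>r<length M. (M ! r) p)"
      using l' p by (intro sum.cong) (simp_all add: U_def)
    also have "\<dots> = 1"
      using M p by (simp add: max_informative_def is_measurement_def)
    finally show "(\<Sum>s<length N. (N ! s) p) = 1" .
  qed
  define f where "f s = fst (xs ! s)" for s
  have ref: "refines_via S N f M"
    unfolding refines_via_def
  proof (intro conjI allI impI)
    fix s assume "s < length N"
    then have "xs ! s \<in> set xs" by (simp add: len)
    then show "f s < length M"
      by (auto simp: xs(1) f_def)
  next
    fix r p assume r: "r < length M" and p: "is_state S p"
    have "(\<Sum>s\<in>{s. s < length N \<and> f s = r}. (N!s) p)
        = (\<Sum>s<length xs. if f s = r then (N!s) p else 0)"
      by (simp add: sum.If_cases len Int_def conj_commute)
    also have "\<dots> = (\<Sum>s<length xs. (\<lambda>(r', a, x). if r' = r then l r' a x * p a x else 0) (xs ! s))"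
      by (intro sum.cong) (auto simp: N_def f_def case_prod_unfold)
    also have "\<dots> = (\<Sum>(r', a, x)\<in>{..<length M} \<times> U. if r' = r then l r' a x * p a x else 0)"
      by (simp only: sum_nth_distinct[OF xs(2)] xs(1))
    also have "\<dots> = (\<Sum>r'<length M. \<Sum>(a, x)\<in>U. if r' = r then l r' a x * p a x else 0)"
      by (rule sum.cartesian_product[symmetric])
    also have "\<dots> = (\<Sum>r'<length M. if r' = r then \<Sum>(a, x)\<in>U. l r a x * p a x else 0)"
      by (intro sum.cong) auto
    also have "\<dots> = (M ! r) p"
      using r l'[OF r p] by (simp add: U_def)
    finally show "(M ! r) p = (\<Sum>s\<in>{s. s < length N \<and> f s = r}. (N!s) p)" ..
  qed
  have triv: "\<exists>c. \<forall>p. is_state S p \<longrightarrow> l r a x * p a x = c * (M ! r) p"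
    if r: "r < length M" and ax: "(a, x) \<in> U" for r a x
  proof -
    have "(r, a, x) \<in> set xs" using r ax xs(1) by simp
    then obtain s where s: "s < length xs" "xs ! s = (r, a, x)"
      by (auto simp: in_set_conv_nth)
    have "trivial_refinement S N f M"
      using M meas ref by (simp add: max_informative_def)
    then have "\<exists>c. \<forall>p. is_state S p \<longrightarrow> (N ! s) p = c * (M ! f s) p"
      using s(1) len by (simp add: trivial_refinement_def)
    then show ?thesis using s by (simp add: N_def f_def)
  qed
  have "\<exists>c a x. 0 \<le> c \<and> valid_out S a \<and> valid_in S x \<and> (\<forall>p. is_state S p \<longrightarrow> (M ! r) p = c * p a x)"
    if r: "r < length M" for r
  proof (cases "\<exists>a x. (a, x) \<in> U \<and> l r a x \<noteq> 0")
    \<comment> \<open>A vanishing outcome is represented by any valid pair \<open>(a, x)\<close>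
      with coefficient 0.\<close>
    case False
    then have "(M ! r) p = 0 * p a x" if "is_state S p" for a x p
      using l'[OF r that] by (auto simp: U_def intro!: sum.neutral)
    then show ?thesis
      using S valid_out_zeros valid_in_zeros by (metis order.refl)
  next
    case True
    then obtain a x where ax: "(a, x) \<in> U" and pos: "l r a x > 0"
      using l[OF r] by (metis less_eq_real_def)
    then have valid: "valid_out S a" "valid_in S x" by (auto simp: U_def outs_def ins_def)
    obtain c where c: "\<And>p. is_state S p \<Longrightarrow> l r a x * p a x = c * (M ! r) p"
      using triv[OF r ax] by blast
    \<comment> \<open>Evaluation at a state with \<open>q a x = 1\<close> shows
      \<open>c > 0\<close>, so that the proportionality can be inverted.\<close>
    obtain q where q: "is_state S q" "q a x = 1"
      using state_attaining_1[OF S valid] by blast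
    have "c * (M ! r) q > 0" using c[OF q(1)] q(2) pos by simp
    moreover have "0 \<le> (M ! r) q" using eff[OF r] q(1) by (simp add: is_effect_def)
    ultimately have "c > 0" by (simp add: zero_less_mult_iff)
    then have "(M ! r) p = l r a x / c * p a x" if "is_state S p" for p
      using c[OF that] by (simp add: field_simps)
    moreover have "0 \<le> l r a x / c" using \<open>c > 0\<close> pos by simp
    ultimately show ?thesis using valid by blast
  qed
  then have "\<forall>r\<in>{..<length M}. \<exists>w. 0 \<le> fst w \<and> valid_out S (fst (snd w)) \<and> valid_in S (snd (snd w)) \<and>
      (\<forall>p. is_state S p \<longrightarrow> (M ! r) p = fst w * p (fst (snd w)) (snd (snd w)))"
    by simp
  from bchoice[OF this] obtain w where w: "\<forall>r\<in>{..<length M}. 0 \<le> fst (w r) \<and>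
      valid_out S (fst (snd (w r))) \<and> valid_in S (snd (snd (w r))) \<and>
      (\<forall>p. is_state S p \<longrightarrow> (M ! r) p = fst (w r) * p (fst (snd (w r))) (snd (snd (w r))))"
    by (elim exE)
  define C A X where "C r = fst (w r)" and "A r = fst (snd (w r))" and "X r = snd (snd (w r))" for r
  have CAX: "\<And>r. r < length M \<Longrightarrow> 0 \<le> C r \<and> valid_out S (A r) \<and> valid_in S (X r)"
    "\<And>r p. r < length M \<Longrightarrow> is_state S p \<Longrightarrow> (M ! r) p = C r * p (A r) (X r)"
    using w by (simp_all add: C_def A_def X_def)
  have "fiducial_measurement S {..<length M} C A X"
    unfolding fiducial_measurement_def
  proof (intro conjI allI impI)
    show "(\<Sum>r<length M. C r * p (A r) (X r)) = 1" if p: "is_state S p" for p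
    proof -
      have "(\<Sum>r<length M. C r * p (A r) (X r)) = (\<Sum>r<length M. (M ! r) p)"
        using CAX(2) p by (intro sum.cong) auto
      then show ?thesis
        using M p by (simp add: max_informative_def is_measurement_def)
    qed
  qed (use CAX(1) in auto)
  moreover have "outcome_entropy M p = (\<Sum>r<length M. eta (C r * p (A r) (X r)))"
    if "is_state S p" for p
    unfolding outcome_entropy_eta using CAX(2) that by (intro sum.cong) auto
  ultimately show ?thesis using that by blast
qed

section \<open>Bounds on the measurement entropy\<close>

lemma fiducial_measurement_entropy_nonneg:
  assumes M: "fiducial_measurement S I C A X" and p: "is_state S p"
  shows "0 \<le> (\<Sum>i\<in>I. eta (C i * p (A i) (X i)))"
proof -
  have "0 \<le> C i * p (A i) (X i)" if "i \<in> I" for i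
    using M that p by (auto simp: fiducial_measurement_def state_nonneg)
  then show ?thesis
    using fiducial_measurement_term_le_1[OF M _ p] by (intro sum_nonneg eta_nonneg) auto
qed

lemma outcome_entropy_nonneg:
  assumes "is_boxsys S" "max_informative S M" "is_state S p"
  shows "0 \<le> outcome_entropy M p"
proof -
  obtain C A X where M: "fiducial_measurement S {..<length M} C A X"
    and H: "\<And>p. is_state S p \<Longrightarrow> outcome_entropy M p = (\<Sum>r<length M. eta (C r * p (A r) (X r)))"
    using max_informative_fiducial[OF assms(1,2)] by blast
  show ?thesis unfolding H[OF assms(3)] by (rule fiducial_measurement_entropy_nonneg[OF M assms(3)])
qed

lemma meas_entropy_le_outcome:
  assumes "is_boxsys S" "max_informative S M" "is_state S p"
  shows "meas_entropy S p \<le> outcome_entropy M p"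
  unfolding meas_entropy_def
  by (rule cInf_lower) (use assms outcome_entropy_nonneg in \<open>auto intro!: bdd_belowI[of _ 0]\<close>)

lemma meas_entropy_le:
  assumes "is_boxsys S" "fiducial_measurement S I C A X" "is_state S p"
  shows "meas_entropy S p \<le> (\<Sum>i\<in>I. eta (C i * p (A i) (X i)))"
proof -
  obtain L where L: "max_informative S L"
    and H: "\<And>p. outcome_entropy L p = (\<Sum>i\<in>I. eta (C i * p (A i) (X i)))"
    using fiducial_measurement_max_informative[OF assms(1,2)] by blast
  show ?thesis using meas_entropy_le_outcome[OF assms(1) L assms(3)] by (simp only: H)
qed

text \<open>Witness that maximally informative measurements exist, and the measurement behind the
  local upper bound in \<open>meas_entropy_flag_hidden\<close>.\<close>

lemma fiducial_measurement_fixed_input: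
  assumes "valid_in S x"
  shows "fiducial_measurement S (outs S) (\<lambda>_. 1) (\<lambda>a. a) (\<lambda>_. x)"
  using assms by (simp add: fiducial_measurement_def outs_def[symmetric] is_state_altdef) (simp add: outs_def)

text \<open>By \<open>max_informative_fiducial\<close> only fiducial measurements have to be tested;
  fixed inputs show that the infimum is over a nonempty set.\<close>

lemma meas_entropy_ge:
  assumes S: "is_boxsys S" and p: "is_state S p"
    and h: "\<And>(n::nat) C A X. fiducial_measurement S {..<n} C A X \<Longrightarrow>
      h \<le> (\<Sum>i<n. eta (C i * p (A i) (X i)))"
  shows "h \<le> meas_entropy S p"
  unfolding meas_entropy_def
proof (rule cInf_greatest)
  obtain L where "max_informative S L"
    using fiducial_measurement_max_informative[OF S
        fiducial_measurement_fixed_input[OF valid_in_zeros[OF S]]] by blast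
  then show "{outcome_entropy M p | M. max_informative S M} \<noteq> {}" by blast
  fix t assume "t \<in> {outcome_entropy M p | M. max_informative S M}"
  then obtain M where M: "max_informative S M" "t = outcome_entropy M p" by blast
  obtain C A X where L: "fiducial_measurement S {..<length M} C A X"
    and H: "\<And>p. is_state S p \<Longrightarrow> outcome_entropy M p = (\<Sum>r<length M. eta (C r * p (A r) (X r)))"
    using max_informative_fiducial[OF S M(1)] by blast
  show "h \<le> t" using h[OF L] unfolding M(2) H[OF p] .
qed

lemma meas_entropy_nonneg: "is_boxsys S \<Longrightarrow> is_state S p \<Longrightarrow> 0 \<le> meas_entropy S p"
  by (intro meas_entropy_ge fiducial_measurement_entropy_nonneg)

text \<open>The lower bounds come from linear programming duality: the coefficients \<open>c\<close> of a
  measurement satisfy \<open>c \<le> 1\<close>, so \<open>\<eta>(c p) \<ge> c \<eta>(p) \<ge> c q\<close>, and the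
  total of the \<open>c q\<close> does not depend on the measurement.\<close>

lemma meas_entropy_ge_weight:
  assumes S: "is_boxsys S" and p: "is_state S p" and q: "state_cone S q"
    and le: "\<And>a x. valid_out S a \<Longrightarrow> valid_in S x \<Longrightarrow> q a x \<le> eta (p a x)"
  shows "weight S q \<le> meas_entropy S p"
proof (rule meas_entropy_ge[OF S p])
  fix n :: nat and C A X
  assume M: "fiducial_measurement S {..<n} C A X"
  have "C i * q (A i) (X i) \<le> eta (C i * p (A i) (X i))" if i: "i < n" for i
  proof -
    have C: "0 \<le> C i" "valid_out S (A i)" "valid_in S (X i)"
      using M i by (auto simp: fiducial_measurement_def)
    have "C i \<le> 1"
      using fiducial_measurement_coeff_le_1[OF M S] i by simp
    then have "0 \<le> p (A i) (X i) * eta (C i)"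
      using C(1) eta_nonneg state_nonneg[OF p] by simp
    moreover have "C i * q (A i) (X i) \<le> C i * eta (p (A i) (X i))"
      using C le by (simp add: mult_left_mono)
    ultimately show ?thesis
      using eta_mult[OF C(1) state_nonneg[OF p]] by simp
  qed
  then have "(\<Sum>i<n. C i * q (A i) (X i)) \<le> (\<Sum>i<n. eta (C i * p (A i) (X i)))"
    by (intro sum_mono) simp
  then show "weight S q \<le> (\<Sum>i<n. eta (C i * p (A i) (X i)))"
    using fiducial_measurement_weight[OF M S q] by simp
qed

section \<open>Slices and marginals of bipartite states\<close>

lemma state_cone_slice_left:
  assumes p: "state_cone (S @ T) p" and b: "valid_out T b" "valid_in T y"
  shows "state_cone S (\<lambda>a x. p (a @ b) (x @ y))"
  unfolding state_cone_def
proof (intro conjI allI no_signallingI)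
  have ns: "no_signalling (S @ T) p" using p by (simp add: state_cone_def)
  have len: "length b = length T" "length y = length T"
    using b by (auto simp: valid_out_def valid_in_def)
  show "p (a @ b) (x @ y) = 0" if "\<not> (valid_out S a \<and> valid_in S x)" for a x
    using no_signalling_support[OF ns, of "a @ b" "x @ y"] that
    by (simp add: valid_out_append valid_in_append len b)
  fix i a x x'
  assume i: "i < length S" and a: "valid_out S a" and x: "valid_in S x" and x': "valid_in S x'"
    and eq: "\<forall>j<length S. j \<noteq> i \<longrightarrow> x ! j = x' ! j"
  have l: "length a = length S" "length x = length S" "length x' = length S"
    using a x x' by (auto simp: valid_out_def valid_in_def)
  have "(\<Sum>t<snd ((S @ T) ! i). p ((a @ b)[i := t]) (x @ y))
      = (\<Sum>t<snd ((S @ T) ! i). p ((a @ b)[i := t]) (x' @ y))"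
    by (rule no_signallingD[OF ns])
      (use i eq a x x' b l in \<open>simp_all add: valid_out_append' valid_in_append' nth_append\<close>)
  then show "(\<Sum>t<snd (S ! i). p (a[i := t] @ b) (x @ y))
      = (\<Sum>t<snd (S ! i). p (a[i := t] @ b) (x' @ y))"
    using i l by (simp add: nth_append list_update_append)
qed (use p in \<open>simp add: state_cone_def\<close>)

lemma state_cone_slice_right:
  assumes p: "state_cone (S @ T) p" and a: "valid_out S a" "valid_in S x"
  shows "state_cone T (\<lambda>b y. p (a @ b) (x @ y))"
  unfolding state_cone_def
proof (intro conjI allI no_signallingI)
  have ns: "no_signalling (S @ T) p" using p by (simp add: state_cone_def)
  have len: "length a = length S" "length x = length S"
    using a by (auto simp: valid_out_def valid_in_def)
  show "p (a @ b) (x @ y) = 0" if "\<not> (valid_out T b \<and> valid_in T y)" for b y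
    using no_signalling_support[OF ns, of "a @ b" "x @ y"] that
    by (simp add: valid_out_append' valid_in_append' len a)
  fix i b y y'
  assume i: "i < length T" and b: "valid_out T b" and y: "valid_in T y" and y': "valid_in T y'"
    and eq: "\<forall>j<length T. j \<noteq> i \<longrightarrow> y ! j = y' ! j"
  have eq': "\<forall>j<length (S @ T). j \<noteq> length S + i \<longrightarrow> (x @ y) ! j = (x @ y') ! j"
  proof (intro allI impI)
    fix j assume j: "j < length (S @ T)" "j \<noteq> length S + i"
    show "(x @ y) ! j = (x @ y') ! j"
    proof (cases "j < length S")
      case False
      then have "j - length S < length T" "j - length S \<noteq> i" using j by auto
      then show ?thesis using eq False by (simp add: nth_append len)
    qed (simp add: nth_append len)
  qed
  have "(\<Sum>t<snd ((S @ T) ! (length S + i)). p ((a @ b)[length S + i := t]) (x @ y))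
      = (\<Sum>t<snd ((S @ T) ! (length S + i)). p ((a @ b)[length S + i := t]) (x @ y'))"
    by (rule no_signallingD[OF ns _ _ _ _ eq'])
      (use i a b y y' len in \<open>simp_all add: valid_out_append' valid_in_append'\<close>)
  then show "(\<Sum>t<snd (T ! i). p (a @ b[i := t]) (x @ y))
      = (\<Sum>t<snd (T ! i). p (a @ b[i := t]) (x @ y'))"
    using len by (simp add: nth_append list_update_append)
qed (use p in \<open>simp add: state_cone_def\<close>)

text \<open>Since \<open>p\<close> vanishes off the valid tuples, the marginal is a plain sum of
  slices, each an unnormalized state.\<close>

lemma marg_X_eq:
  assumes "state_cone (S @ T) p" "is_boxsys T"
  shows "marg_X S T p = (\<lambda>a x. \<Sum>b\<in>outs T. p (a @ b) (x @ replicate (length T) 0))"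
proof (intro ext)
  fix a x
  have "p (a @ b) (x @ replicate (length T) 0) = 0"
    if "b \<in> outs T" "\<not> (valid_out S a \<and> valid_in S x)" for b
    using state_cone_slice_left[OF assms(1), of b "replicate (length T) 0"] that assms(2)
      no_signalling_support[of S "\<lambda>a x. p (a @ b) (x @ replicate (length T) 0)" a x]
    by (simp add: outs_def state_cone_def)
  then show "marg_X S T p a x = (\<Sum>b\<in>outs T. p (a @ b) (x @ replicate (length T) 0))"
    unfolding marg_X_def by (auto intro!: sum.neutral[symmetric])
qed

lemma marg_Y_eq:
  assumes "state_cone (S @ T) p" "is_boxsys S"
  shows "marg_Y S T p = (\<lambda>b y. \<Sum>a\<in>outs S. p (a @ b) (replicate (length S) 0 @ y))"
proof (intro ext)
  fix b y
  have "p (a @ b) (replicate (length S) 0 @ y) = 0"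
    if "a \<in> outs S" "\<not> (valid_out T b \<and> valid_in T y)" for a
    using state_cone_slice_right[OF assms(1), of a "replicate (length S) 0"] that assms(2)
      no_signalling_support[of T "\<lambda>b y. p (a @ b) (replicate (length S) 0 @ y)" b y]
    by (simp add: outs_def state_cone_def)
  then show "marg_Y S T p b y = (\<Sum>a\<in>outs S. p (a @ b) (replicate (length S) 0 @ y))"
    unfolding marg_Y_def by (auto intro!: sum.neutral[symmetric])
qed

lemma is_state_marg_X:
  assumes S: "is_boxsys S" and T: "is_boxsys T" and p: "is_state (S @ T) p"
  shows "is_state S (marg_X S T p)"
proof -
  have p': "state_cone (S @ T) p" "weight (S @ T) p = 1"
    using p S T by (simp_all add: is_state_iff is_boxsys_append)
  have "weight S (marg_X S T p) = 1"
    using p'(2) unfolding marg_X_eq[OF p'(1) T]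
    by (simp add: weight_def sum_outs_append replicate_add)
  moreover have "state_cone S (marg_X S T p)"
    unfolding marg_X_eq[OF p'(1) T]
    by (intro state_cone_sum state_cone_slice_left[OF p'(1)]) (simp_all add: T outs_def)
  ultimately show ?thesis by (simp add: is_state_iff[OF S])
qed

lemma is_state_marg_Y:
  assumes S: "is_boxsys S" and T: "is_boxsys T" and p: "is_state (S @ T) p"
  shows "is_state T (marg_Y S T p)"
proof -
  have p': "state_cone (S @ T) p" "weight (S @ T) p = 1"
    using p S T by (simp_all add: is_state_iff is_boxsys_append)
  have "weight T (marg_Y S T p) = weight (S @ T) p"
    unfolding marg_Y_eq[OF p'(1) S] weight_def sum_outs_append replicate_add length_append
    by (rule sum.swap)
  moreover have "state_cone T (marg_Y S T p)"
    unfolding marg_Y_eq[OF p'(1) S]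
    by (intro state_cone_sum state_cone_slice_right[OF p'(1)]) (simp_all add: S outs_def)
  ultimately show ?thesis using p'(2) by (simp add: is_state_iff[OF T])
qed

text \<open>Fixing \<open>b\<close> and \<open>y\<close> leaves an unnormalized state of
  \<open>S\<close>. Every fiducial measurement on \<open>S\<close> sums to its weight, which is the
  entry of the marginal.\<close>

lemma fiducial_measurement_sum_left:
  assumes S: "is_boxsys S" and T: "is_boxsys T" and p: "is_state (S @ T) p"
    and M: "fiducial_measurement S I C A X" and b: "valid_out T b" "valid_in T y"
  shows "(\<Sum>i\<in>I. C i * p (A i @ b) (X i @ y)) = marg_Y S T p b y"
proof -
  have p': "state_cone (S @ T) p"
    using p S T by (simp add: is_state_iff is_boxsys_append)
  show ?thesis
    using fiducial_measurement_weight[OF M S state_cone_slice_left[OF p' b]]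
    by (simp add: marg_Y_eq[OF p' S] weight_def)
qed

lemma fiducial_measurement_sum_right:
  assumes S: "is_boxsys S" and T: "is_boxsys T" and p: "is_state (S @ T) p"
    and N: "fiducial_measurement T J D B Y" and a: "valid_out S a" "valid_in S x"
  shows "(\<Sum>j\<in>J. D j * p (a @ B j) (x @ Y j)) = marg_X S T p a x"
proof -
  have p': "state_cone (S @ T) p"
    using p S T by (simp add: is_state_iff is_boxsys_append)
  show ?thesis
    using fiducial_measurement_weight[OF N T state_cone_slice_right[OF p' a]]
    by (simp add: marg_X_eq[OF p' T] weight_def)
qed

text \<open>Summing over the outcomes on \<open>S\<close> first produces the marginal on
  \<open>T\<close>, on which the second measurement is normalized.\<close>

lemma fiducial_measurement_product:
  assumes S: "is_boxsys S" and T: "is_boxsys T"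
    and M: "fiducial_measurement S I C A X" and N: "fiducial_measurement T J D B Y"
  shows "fiducial_measurement (S @ T) (I \<times> J) (\<lambda>(i, j). C i * D j)
    (\<lambda>(i, j). A i @ B j) (\<lambda>(i, j). X i @ Y j)"
  unfolding fiducial_measurement_def
proof (intro conjI allI impI ballI)
  have fin: "finite I" "finite J"
    and v: "\<And>i. i \<in> I \<Longrightarrow> 0 \<le> C i \<and> valid_out S (A i) \<and> valid_in S (X i)"
    "\<And>j. j \<in> J \<Longrightarrow> 0 \<le> D j \<and> valid_out T (B j) \<and> valid_in T (Y j)"
    using M N by (auto simp: fiducial_measurement_def)
  show "finite (I \<times> J)" using fin by simp
  fix k assume "k \<in> I \<times> J"
  then obtain i j where k: "k = (i, j)" "i \<in> I" "j \<in> J" by blast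
  have "length (B j) = length T" "length (Y j) = length T"
    using v(2)[OF k(3)] by (auto simp: valid_out_def valid_in_def)
  then show "0 \<le> (case k of (i, j) \<Rightarrow> C i * D j)"
    "valid_out (S @ T) (case k of (i, j) \<Rightarrow> A i @ B j)"
    "valid_in (S @ T) (case k of (i, j) \<Rightarrow> X i @ Y j)"
    using v(1)[OF k(2)] v(2)[OF k(3)] by (simp_all add: k valid_out_append valid_in_append)
next
  have v: "\<And>j. j \<in> J \<Longrightarrow> 0 \<le> D j \<and> valid_out T (B j) \<and> valid_in T (Y j)"
    using N by (auto simp: fiducial_measurement_def)
  fix p assume p: "is_state (S @ T) p"
  have "(\<Sum>k\<in>I \<times> J. (case k of (i, j) \<Rightarrow> C i * D j)
        * p (case k of (i, j) \<Rightarrow> A i @ B j) (case k of (i, j) \<Rightarrow> X i @ Y j))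
      = (\<Sum>i\<in>I. \<Sum>j\<in>J. C i * D j * p (A i @ B j) (X i @ Y j))"
    by (simp add: sum.cartesian_product case_prod_unfold)
  also have "\<dots> = (\<Sum>j\<in>J. \<Sum>i\<in>I. C i * D j * p (A i @ B j) (X i @ Y j))"
    by (rule sum.swap)
  also have "\<dots> = (\<Sum>j\<in>J. D j * marg_Y S T p (B j) (Y j))"
  proof (rule sum.cong[OF refl])
    fix j assume "j \<in> J"
    then have "(\<Sum>i\<in>I. C i * p (A i @ B j) (X i @ Y j)) = marg_Y S T p (B j) (Y j)"
      using fiducial_measurement_sum_left[OF S T p M] v by blast
    then show "(\<Sum>i\<in>I. C i * D j * p (A i @ B j) (X i @ Y j)) = D j * marg_Y S T p (B j) (Y j)"
      by (simp add: sum_distrib_left ac_simps flip: \<open>_ = marg_Y S T p (B j) (Y j)\<close>)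
  qed
  also have "\<dots> = 1"
    using N is_state_marg_Y[OF S T p] by (simp add: fiducial_measurement_def)
  finally show "(\<Sum>k\<in>I \<times> J. (case k of (i, j) \<Rightarrow> C i * D j)
        * p (case k of (i, j) \<Rightarrow> A i @ B j) (case k of (i, j) \<Rightarrow> X i @ Y j)) = 1" .
qed

text \<open>Gibbs' inequality term by term, from \<open>ln z \<le> z - 1\<close> at
  \<open>z = u v / t\<close>. For \<open>t > 0\<close> the assumptions make \<open>u\<close> and
  \<open>v\<close> positive.\<close>

lemma eta_gibbs:
  assumes "0 \<le> t" "t \<le> u" "t \<le> v"
  shows "eta t \<le> t * (- log 2 u) + t * (- log 2 v) + (u * v - t) / ln 2"
proof (cases "t = 0")
  case True
  then show ?thesis using assms by simp
next
  case False
  then have pos: "t > 0" "u > 0" "v > 0" using assms by auto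
  have "ln (u * v / t) \<le> u * v / t - 1"
    using pos by (intro ln_le_minus_one) simp
  then have "t * ln (u * v / t) \<le> u * v - t"
    using pos by (simp add: field_simps)
  then have "t * ln (u * v / t) / ln 2 \<le> (u * v - t) / ln 2"
    by (intro divide_right_mono) simp_all
  moreover have "t * ln (u * v / t) / ln 2 = eta t + t * log 2 u + t * log 2 v"
    using pos by (simp add: eta_def log_def ln_mult ln_div field_simps)
  ultimately show ?thesis by simp
qed

text \<open>\<open>eta_gibbs\<close> is summed with \<open>u\<close> and \<open>v\<close> the two
  marginals; its correction terms add up to \<open>(1 - 1) / ln 2 = 0\<close>.\<close>

lemma shannon_subadditive:
  fixes P :: "'i \<Rightarrow> 'j \<Rightarrow> real"
  assumes "finite I" "finite J" and nonneg: "\<And>i j. i \<in> I \<Longrightarrow> j \<in> J \<Longrightarrow> 0 \<le> P i j"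
    and total: "(\<Sum>i\<in>I. \<Sum>j\<in>J. P i j) = 1"
  shows "(\<Sum>i\<in>I. \<Sum>j\<in>J. eta (P i j)) \<le>
    (\<Sum>i\<in>I. eta (\<Sum>j\<in>J. P i j)) + (\<Sum>j\<in>J. eta (\<Sum>i\<in>I. P i j))"
proof -
  define u where "u i = (\<Sum>j\<in>J. P i j)" for i
  define v where "v j = (\<Sum>i\<in>I. P i j)" for j
  have tot: "(\<Sum>i\<in>I. u i) = 1" "(\<Sum>j\<in>J. v j) = 1"
    using total sum.swap[of P J I] by (simp_all add: u_def v_def)
  have "(\<Sum>i\<in>I. \<Sum>j\<in>J. eta (P i j)) \<le>
      (\<Sum>i\<in>I. \<Sum>j\<in>J. P i j * (- log 2 (u i)) + P i j * (- log 2 (v j)) + (u i * v j - P i j) / ln 2)"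
  proof (intro sum_mono eta_gibbs)
    fix i j assume "i \<in> I" "j \<in> J"
    then show "0 \<le> P i j" "P i j \<le> u i" "P i j \<le> v j"
      unfolding u_def v_def using assms(1,2) nonneg
      by (auto intro: member_le_sum[of j J "P i"] member_le_sum[of i I "\<lambda>i. P i j"])
  qed
  also have "\<dots> = (\<Sum>i\<in>I. \<Sum>j\<in>J. P i j * (- log 2 (u i))) + (\<Sum>i\<in>I. \<Sum>j\<in>J. P i j * (- log 2 (v j)))
      + ((\<Sum>i\<in>I. \<Sum>j\<in>J. u i * v j) - (\<Sum>i\<in>I. \<Sum>j\<in>J. P i j)) / ln 2"
    by (simp add: sum.distrib sum_subtractf sum_negf flip: sum_divide_distrib)
  also have "(\<Sum>i\<in>I. \<Sum>j\<in>J. u i * v j) = 1"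
    using tot by (simp flip: sum_product)
  also have "(\<Sum>i\<in>I. \<Sum>j\<in>J. P i j * (- log 2 (v j))) = (\<Sum>j\<in>J. \<Sum>i\<in>I. P i j * (- log 2 (v j)))"
    by (rule sum.swap)
  also have "(\<Sum>i\<in>I. \<Sum>j\<in>J. P i j * (- log 2 (u i))) = (\<Sum>i\<in>I. eta (u i))"
    unfolding sum_distrib_right[symmetric] by (simp add: eta_def u_def)
  also have "(\<Sum>j\<in>J. \<Sum>i\<in>I. P i j * (- log 2 (v j))) = (\<Sum>j\<in>J. eta (v j))"
    unfolding sum_distrib_right[symmetric] by (simp add: eta_def v_def)
  finally show ?thesis
    using total by (simp add: u_def v_def)
qed

text \<open>The outcome distribution of a product measurement has those of the two local
  measurements as marginals, so Shannon subadditivity applies to it.\<close>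

lemma meas_entropy_subadditive:
  assumes S: "is_boxsys S" and T: "is_boxsys T" and p: "is_state (S @ T) p"
  shows "meas_entropy (S @ T) p \<le> meas_entropy S (marg_X S T p) + meas_entropy T (marg_Y S T p)"
proof -
  have ST: "is_boxsys (S @ T)" using S T by (simp add: is_boxsys_append)
  note pX = is_state_marg_X[OF S T p] and pY = is_state_marg_Y[OF S T p]
  have main: "meas_entropy (S @ T) p \<le> (\<Sum>i<n. eta (C i * marg_X S T p (A i) (X i)))
      + (\<Sum>j<m. eta (D j * marg_Y S T p (B j) (Y j)))"
    if M: "fiducial_measurement S {..<n} C A X" and N: "fiducial_measurement T {..<m} D B Y"
    for n m :: nat and C A X D B Y
  proof -
    define P where "P i j = C i * D j * p (A i @ B j) (X i @ Y j)" for i j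
    note L = fiducial_measurement_product[OF S T M N]
    have v: "\<And>i. i < n \<Longrightarrow> 0 \<le> C i \<and> valid_out S (A i) \<and> valid_in S (X i)"
      "\<And>j. j < m \<Longrightarrow> 0 \<le> D j \<and> valid_out T (B j) \<and> valid_in T (Y j)"
      using M N by (auto simp: fiducial_measurement_def)
    have row: "(\<Sum>j<m. P i j) = C i * marg_X S T p (A i) (X i)" if "i < n" for i
      using fiducial_measurement_sum_right[OF S T p N, of "A i" "X i"] v(1)[OF that]
      by (simp add: P_def mult.assoc flip: sum_distrib_left)
    have col: "(\<Sum>i<n. P i j) = D j * marg_Y S T p (B j) (Y j)" if "j < m" for j
      using fiducial_measurement_sum_left[OF S T p M, of "B j" "Y j"] v(2)[OF that]
      by (simp add: P_def mult.assoc mult.left_commute[of _ "D j"] flip: sum_distrib_left)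
    have "(\<Sum>i<n. \<Sum>j<m. P i j) = (\<Sum>i<n. C i * marg_X S T p (A i) (X i))"
      using row by simp
    also have "\<dots> = 1"
      using M pX by (simp add: fiducial_measurement_def)
    finally have total: "(\<Sum>i<n. \<Sum>j<m. P i j) = 1" .
    have "meas_entropy (S @ T) p \<le> (\<Sum>i<n. \<Sum>j<m. eta (P i j))"
      using meas_entropy_le[OF ST L p] by (simp add: P_def sum.cartesian_product case_prod_unfold)
    also have "\<dots> \<le> (\<Sum>i<n. eta (\<Sum>j<m. P i j)) + (\<Sum>j<m. eta (\<Sum>i<n. P i j))"
      using v p total by (intro shannon_subadditive) (auto simp: P_def state_nonneg)
    also have "\<dots> = (\<Sum>i<n. eta (C i * marg_X S T p (A i) (X i)))
        + (\<Sum>j<m. eta (D j * marg_Y S T p (B j) (Y j)))"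
      using row col by simp
    finally show ?thesis .
  qed
  \<comment> \<open>The infima are taken one after the other: first over measurements on
    \<open>T\<close> with the one on \<open>S\<close> fixed, then over those on
    \<open>S\<close>.\<close>
  have "meas_entropy (S @ T) p - meas_entropy T (marg_Y S T p) \<le> meas_entropy S (marg_X S T p)"
  proof (rule meas_entropy_ge[OF S pX])
    fix n :: nat and C A X assume M: "fiducial_measurement S {..<n} C A X"
    have "meas_entropy (S @ T) p - (\<Sum>i<n. eta (C i * marg_X S T p (A i) (X i)))
        \<le> meas_entropy T (marg_Y S T p)"
      using main[OF M] by (intro meas_entropy_ge[OF T pY]) (simp add: algebra_simps)
    then show "meas_entropy (S @ T) p - meas_entropy T (marg_Y S T p)
        \<le> (\<Sum>i<n. eta (C i * marg_X S T p (A i) (X i)))"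
      by simp
  qed
  then show ?thesis by simp
qed

section \<open>Flags and hidden boxes\<close>

definition single_box :: "nat \<Rightarrow> nat \<Rightarrow> (nat \<Rightarrow> nat \<Rightarrow> real) \<Rightarrow> bstate" where
  "single_box m k g = (\<lambda>a x. if valid_out [(m, k)] a \<and> valid_in [(m, k)] x
     then g (hd x) (hd a) else 0)"

lemma valid_out_single: "valid_out [b] a \<longleftrightarrow> (\<exists>t<snd b. a = [t])"
  by (auto simp: valid_out_list_all2 list_all2_Cons1)

lemma valid_in_single: "valid_in [b] x \<longleftrightarrow> (\<exists>t<fst b. x = [t])"
  by (auto simp: valid_in_list_all2 list_all2_Cons1)

lemma single_box_apply [simp]: "t < k \<Longrightarrow> u < m \<Longrightarrow> single_box m k g [t] [u] = g u t"
  by (simp add: single_box_def valid_out_single valid_in_single)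

text \<open>The common total \<open>c\<close> is left open because certificates, whose entries are
  entropies, are built from single boxes as well.\<close>

lemma state_cone_single_box:
  assumes nonneg: "\<And>u t. u < m \<Longrightarrow> t < k \<Longrightarrow> 0 \<le> g u t"
    and total: "\<And>u. u < m \<Longrightarrow> (\<Sum>t<k. g u t) = c"
  shows "state_cone [(m, k)] (single_box m k g)"
  unfolding state_cone_def
proof (intro conjI allI no_signallingI)
  fix i a x x'
  assume "i < length [(m, k)]" and a: "valid_out [(m, k)] a"
    and x: "valid_in [(m, k)] x" and x': "valid_in [(m, k)] x'"
  then have i: "i = 0" by simp
  obtain t u u' where "a = [t]" "x = [u]" "x' = [u']" "u < m" "u' < m"
    using a x x' by (auto simp: valid_out_single valid_in_single)
  then show "(\<Sum>t<snd ([(m, k)] ! i). single_box m k g (a[i := t]) x)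
      = (\<Sum>t<snd ([(m, k)] ! i). single_box m k g (a[i := t]) x')"
    using total by (simp add: i)
qed (auto simp: single_box_def valid_out_single valid_in_single nonneg)

lemma weight_single_box: "0 < m \<Longrightarrow> weight [(m, k)] (single_box m k g) = (\<Sum>t<k. g 0 t)"
  by (simp add: weight_def sum_outs_Cons outs_Nil)

definition product_state :: "boxsys \<Rightarrow> bstate \<Rightarrow> bstate \<Rightarrow> bstate" where
  "product_state S q r = (\<lambda>a x.
     q (take (length S) a) (take (length S) x) * r (drop (length S) a) (drop (length S) x))"

lemma product_state_append:
  "length a = length S \<Longrightarrow> length x = length S \<Longrightarrow> product_state S q r (a @ b) (x @ y) = q a x * r b y"
  by (simp add: product_state_def)

lemma product_state_Cons [simp]:
  "product_state [s] q r (t # a) (u # x) = q [t] [u] * r a x"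
  by (simp add: product_state_def)

lemma state_cone_product_state:
  assumes q: "state_cone S q" and r: "state_cone T r"
  shows "state_cone (S @ T) (product_state S q r)"
  unfolding state_cone_def
proof (intro conjI allI no_signallingI)
  have nq: "no_signalling S q" and nr: "no_signalling T r"
    using q r by (simp_all add: state_cone_def)
  show "product_state S q r a x = 0" if "\<not> (valid_out (S @ T) a \<and> valid_in (S @ T) x)" for a x
    using that no_signalling_support[OF nq] no_signalling_support[OF nr]
    unfolding product_state_def valid_out_take_drop valid_in_take_drop mult_eq_0_iff by blast
  fix i a x x'
  assume i: "i < length (S @ T)" and a: "valid_out (S @ T) a"
    and x: "valid_in (S @ T) x" and x': "valid_in (S @ T) x'"
    and eq: "\<forall>j<length (S @ T). j \<noteq> i \<longrightarrow> x ! j = x' ! j"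
  have l: "length a = length S + length T" "length x = length S + length T"
    "length x' = length S + length T"
    using a x x' by (simp_all add: valid_out_def valid_in_def)
  let ?n = "length S"
  have v: "valid_out S (take ?n a)" "valid_out T (drop ?n a)" "valid_in S (take ?n x)"
    "valid_in T (drop ?n x)" "valid_in S (take ?n x')" "valid_in T (drop ?n x')"
    using a x x' by (simp_all only: valid_out_take_drop valid_in_take_drop)
  show "(\<Sum>t<snd ((S @ T) ! i). product_state S q r (a[i := t]) x)
      = (\<Sum>t<snd ((S @ T) ! i). product_state S q r (a[i := t]) x')"
  \<comment> \<open>The factor that does not contain box \<open>i\<close> has equal inputs on both
    sides and comes out of the sum.\<close>
  proof (cases "i < ?n")
    case True
    have "drop ?n x = drop ?n x'"
      using l True eq by (intro nth_equalityI) auto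
    moreover have "(\<Sum>t<snd (S ! i). q ((take ?n a)[i := t]) (take ?n x))
        = (\<Sum>t<snd (S ! i). q ((take ?n a)[i := t]) (take ?n x'))"
      using True eq by (intro no_signallingD[OF nq True v(1,3,5)]) simp
    ultimately show ?thesis
      using True by (simp add: product_state_def nth_append take_update_swap drop_update_cancel
          flip: sum_distrib_right)
  next
    case False
    then have k: "i - ?n < length T" using i by simp
    have "take ?n x = take ?n x'"
      using l False eq by (intro nth_equalityI) auto
    moreover have "(\<Sum>t<snd (T ! (i - ?n)). r ((drop ?n a)[i - ?n := t]) (drop ?n x))
        = (\<Sum>t<snd (T ! (i - ?n)). r ((drop ?n a)[i - ?n := t]) (drop ?n x'))"
      using l False eq by (intro no_signallingD[OF nr k v(2,4,6)]) auto
    ultimately show ?thesis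
      using False by (simp add: product_state_def nth_append take_update_cancel drop_update_swap
          flip: sum_distrib_left)
  qed
qed (use q r in \<open>simp add: state_cone_def product_state_def\<close>)

lemma weight_product_state: "weight (S @ T) (product_state S q r) = weight S q * weight T r"
proof -
  have "weight (S @ T) (product_state S q r) = (\<Sum>a\<in>outs S. \<Sum>b\<in>outs T.
      q a (replicate (length S) 0) * r b (replicate (length T) 0))"
    unfolding weight_def sum_outs_append length_append replicate_add
    by (intro sum.cong product_state_append) (auto simp: outs_def valid_out_def)
  then show ?thesis by (simp add: weight_def sum_product)
qed

lemmas state_cone_product_state_Cons =
  state_cone_product_state[of "[s]" q T r for s q T r, unfolded append_Cons append_Nil]
lemmas weight_product_state_Cons =
  weight_product_state[of "[s]" T q r for s q T r, unfolded append_Cons append_Nil]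

text \<open>For \<open>K\<close> exponential in \<open>1 / \<epsilon>\<close> the flag carries entropy about \<open>\<epsilon> log K\<close>, although
  whether it is zero carries almost none. Meant for arguments \<open>t \<le> K\<close>.\<close>

definition flag :: "real \<Rightarrow> nat \<Rightarrow> nat \<Rightarrow> real" where
  "flag \<epsilon> K t = (if t = 0 then 1 - \<epsilon> else \<epsilon> / real K)"

text \<open>The input \<open>b\<close> is the good one. The other never yields 0, so that on input 0
  the mixture \<open>hidden_mix\<close> has exactly the distribution
  \<open>flag \<epsilon> K\<close>.\<close>

definition hidden :: "nat \<Rightarrow> nat \<Rightarrow> nat \<Rightarrow> nat \<Rightarrow> real" where
  "hidden K b u t = (if u = b then of_bool (t = 0) else if t = 0 then 0 else 1 / real K)"

text \<open>The hidden box as seen without the flag of the other side, which is nonzero with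
  probability \<epsilon>.\<close>

definition hidden_mix :: "real \<Rightarrow> nat \<Rightarrow> nat \<Rightarrow> nat \<Rightarrow> real" where
  "hidden_mix \<epsilon> K u t = (1 - \<epsilon>) * hidden K 0 u t + \<epsilon> * hidden K 1 u t"

text \<open>Shannon entropy of \<open>flag \<epsilon> K\<close> for \<open>K > 0\<close>: the binary
  entropy of \<epsilon> plus the uniform choice among \<open>K\<close> values, made with probability
  \<epsilon>.\<close>

definition flag_entropy :: "real \<Rightarrow> nat \<Rightarrow> real" where
  "flag_entropy \<epsilon> K = eta (1 - \<epsilon>) + eta \<epsilon> + \<epsilon> * log 2 (real K)"

lemma sum_flag_1: "0 < K \<Longrightarrow> (\<Sum>t<Suc K. flag \<epsilon> K t) = 1"
  unfolding sum.lessThan_Suc_shift by (simp add: flag_def)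

lemma sum_hidden: "0 < K \<Longrightarrow> (\<Sum>t<Suc K. hidden K b u t) = 1"
  unfolding sum.lessThan_Suc_shift by (simp add: hidden_def)

lemma sum_hidden_mix: "0 < K \<Longrightarrow> (\<Sum>t<Suc K. hidden_mix \<epsilon> K u t) = 1"
  by (simp add: hidden_mix_def sum.distrib sum_hidden del: sum.lessThan_Suc flip: sum_distrib_left)

lemma eta_divide:
  "0 < K \<Longrightarrow> 0 \<le> e \<Longrightarrow> eta (e / real K) = eta e / real K + e / real K * log 2 (real K)"
  using eta_mult[of e "1 / real K"] by (simp add: eta_def log_divide)

lemma sum_eta_flag:
  assumes "0 < K" "0 \<le> \<epsilon>"
  shows "(\<Sum>t<Suc K. eta (flag \<epsilon> K t)) = flag_entropy \<epsilon> K"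
  unfolding sum.lessThan_Suc_shift using assms
  by (simp add: flag_def flag_entropy_def eta_divide field_simps)

lemma hidden_bounds: "0 < K \<Longrightarrow> 0 \<le> hidden K b u t \<and> hidden K b u t \<le> 1"
  by (auto simp: hidden_def)

lemma hidden_mix_bounds:
  assumes "0 \<le> \<epsilon>" "\<epsilon> \<le> 1" "0 < K"
  shows "0 \<le> hidden_mix \<epsilon> K u t" "hidden_mix \<epsilon> K u t \<le> 1"
proof -
  have "(1 - \<epsilon>) * hidden K 0 u t + \<epsilon> * hidden K 1 u t \<le> (1 - \<epsilon>) * 1 + \<epsilon> * 1"
    using assms hidden_bounds by (intro add_mono mult_left_mono) auto
  then show "hidden_mix \<epsilon> K u t \<le> 1" by (simp add: hidden_mix_def)
  show "0 \<le> hidden_mix \<epsilon> K u t"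
    using assms hidden_bounds by (simp add: hidden_mix_def)
qed

lemma sum_eta_mult:
  assumes "finite I" "finite J" "\<And>i. i \<in> I \<Longrightarrow> 0 \<le> f i" "\<And>j. j \<in> J \<Longrightarrow> 0 \<le> g j"
    and "(\<Sum>i\<in>I. f i) = 1" "(\<Sum>j\<in>J. g j) = 1"
  shows "(\<Sum>i\<in>I. \<Sum>j\<in>J. eta (f i * g j)) = (\<Sum>i\<in>I. eta (f i)) + (\<Sum>j\<in>J. eta (g j))"
proof -
  have "(\<Sum>i\<in>I. \<Sum>j\<in>J. eta (f i * g j)) = (\<Sum>i\<in>I. \<Sum>j\<in>J. g j * eta (f i) + f i * eta (g j))"
    using assms by (intro sum.cong refl eta_mult) auto
  also have "\<dots> = (\<Sum>i\<in>I. eta (f i) + f i * (\<Sum>j\<in>J. eta (g j)))"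
    using assms(6) by (simp add: sum.distrib sum_distrib_left[symmetric] sum_distrib_right[symmetric])
  also have "\<dots> = (\<Sum>i\<in>I. eta (f i)) + (\<Sum>j\<in>J. eta (g j))"
    using assms(5) by (simp add: sum.distrib flip: sum_distrib_right)
  finally show ?thesis .
qed

section \<open>Local entropy of a flag box together with a hidden box\<close>

lemma valid_out_pair:
  "valid_out [(m, k), (m', k')] a \<longleftrightarrow> (\<exists>t t'. t < k \<and> t' < k' \<and> a = [t, t'])"
  by (auto simp: valid_out_list_all2 list_all2_Cons1)

lemma valid_in_pair:
  "valid_in [(m, k), (m', k')] x \<longleftrightarrow> (\<exists>u u'. u < m \<and> u' < m' \<and> x = [u, u'])"
  by (auto simp: valid_in_list_all2 list_all2_Cons1)

text \<open>The upper bound reads the hidden box at input 0, the better guess. The lower bound is a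
  certificate for \<open>meas_entropy_ge_weight\<close>; the two differ only by the binary entropy
  of \<epsilon>.\<close>

lemma meas_entropy_flag_hidden:
  fixes \<epsilon> :: real and N K :: nat
  defines "S \<equiv> [(1, Suc N), (2, Suc K)]"
  assumes e: "0 < \<epsilon>" "\<epsilon> \<le> 1/2" and NK: "0 < N" "0 < K" and p: "is_state S p"
    and val: "\<And>f t u. f \<le> N \<Longrightarrow> t \<le> K \<Longrightarrow> u < 2 \<Longrightarrow> p [f, t] [0, u] = flag \<epsilon> N f * hidden_mix \<epsilon> K u t"
  shows "flag_entropy \<epsilon> N + \<epsilon> * log 2 (real K) \<le> meas_entropy S p"
    and "meas_entropy S p \<le> flag_entropy \<epsilon> N + flag_entropy \<epsilon> K"
proof -
  have S: "is_boxsys S"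
    by (auto simp: is_boxsys_def S_def less_Suc_eq)
  have fl: "0 \<le> flag \<epsilon> N t" "flag \<epsilon> N t \<le> 1" for t N
    using e by (auto simp: flag_def field_simps divide_le_eq)
  have "meas_entropy S p \<le> (\<Sum>a\<in>outs S. eta (1 * p a [0, 0]))"
    by (rule meas_entropy_le[OF S fiducial_measurement_fixed_input p])
      (simp add: S_def valid_in_pair)
  also have "\<dots> = (\<Sum>f<Suc N. \<Sum>t<Suc K. eta (p [f, t] [0, 0]))"
    by (simp add: S_def sum_outs_Cons outs_Nil del: sum.lessThan_Suc)
  \<comment> \<open>At input 0 the entry \<open>hidden_mix \<epsilon> K 0 t\<close> equals
    \<open>flag \<epsilon> K t\<close>.\<close>
  also have "\<dots> = (\<Sum>f<Suc N. \<Sum>t<Suc K. eta (flag \<epsilon> N f * flag \<epsilon> K t))"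
    by (intro sum.cong refl) (auto simp: val hidden_mix_def hidden_def flag_def)
  also have "\<dots> = flag_entropy \<epsilon> N + flag_entropy \<epsilon> K"
    using e NK by (subst sum_eta_mult) (simp_all add: fl sum_flag_1 sum_eta_flag del: sum.lessThan_Suc)
  finally show "meas_entropy S p \<le> flag_entropy \<epsilon> N + flag_entropy \<epsilon> K" .
  \<comment> \<open>\<open>?c\<close> is a lower bound for \<open>eta\<close> of
    \<open>hidden_mix\<close> that is the same for both inputs, hence no-signalling.
    \<open>?q1\<close> and \<open>?q2\<close> are the two terms of \<open>eta_mult\<close> with this
    bound inserted in the second.\<close>
  let ?c = "\<lambda>t. if t = 0 then 0 else \<epsilon> / real K * log 2 (real K)"
  let ?q1 = "product_state [(1, Suc N)] (single_box 1 (Suc N) (\<lambda>_ f. eta (flag \<epsilon> N f)))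
    (single_box 2 (Suc K) (hidden_mix \<epsilon> K))"
  let ?q2 = "product_state [(1, Suc N)] (single_box 1 (Suc N) (\<lambda>_. flag \<epsilon> N))
    (single_box 2 (Suc K) (\<lambda>_. ?c))"
  let ?q = "\<lambda>a x. ?q1 a x + ?q2 a x"
  have logK: "0 \<le> log 2 (real K)" using NK by simp
  have cone: "state_cone S ?q"
    unfolding S_def using e NK logK
    by (intro state_cone_add state_cone_product_state_Cons)
      (rule state_cone_single_box;
        simp add: eta_nonneg fl hidden_mix_bounds sum_hidden_mix del: sum.lessThan_Suc)+
  have sumc: "(\<Sum>t<Suc K. ?c t) = \<epsilon> * log 2 (real K)"
    unfolding sum.lessThan_Suc_shift using NK by simp
  have "weight S ?q = weight S ?q1 + weight S ?q2"
    by (simp add: weight_def sum.distrib)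
  also have "\<dots> = flag_entropy \<epsilon> N + \<epsilon> * log 2 (real K)"
    unfolding S_def weight_product_state_Cons
    using e NK sumc by (simp add: weight_single_box sum_eta_flag sum_flag_1 sum_hidden_mix del: sum.lessThan_Suc)
  finally have weight: "weight S ?q = flag_entropy \<epsilon> N + \<epsilon> * log 2 (real K)" .
  \<comment> \<open>For \<open>t \<noteq> 0\<close> the entry is \<open>d / K\<close> with
    \<open>d\<close> either \<epsilon> or \<open>1 - \<epsilon>\<close>; this is where \<epsilon>
    \<le> 1/2 enters, giving \<open>d \<ge> \<epsilon>\<close>.\<close>
  have hm: "?c t \<le> eta (hidden_mix \<epsilon> K u t)" if "u < 2" for u t
  proof (cases "t = 0")
    case True
    then show ?thesis using hidden_mix_bounds[of \<epsilon> K u t] e NK by (simp add: eta_nonneg)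
  next
    case False
    define d where "d = (if u = 0 then \<epsilon> else 1 - \<epsilon>)"
    have d: "\<epsilon> \<le> d" "0 \<le> d" "d \<le> 1" using e by (auto simp: d_def)
    have "hidden_mix \<epsilon> K u t = d / real K"
      using False that by (auto simp: hidden_mix_def hidden_def d_def less_2_cases_iff)
    moreover have "\<epsilon> / real K * log 2 (real K) \<le> d / real K * log 2 (real K)"
      using d(1) logK NK by (intro mult_right_mono divide_right_mono) auto
    moreover have "0 \<le> eta d / real K" using d eta_nonneg by simp
    ultimately show ?thesis
      using False d NK by (simp add: eta_divide)
  qed
  have "weight S ?q \<le> meas_entropy S p"
  proof (rule meas_entropy_ge_weight[OF S p cone])
    fix a x assume "valid_out S a" "valid_in S x"
    then obtain f t u where ax: "a = [f, t]" "x = [0, u]" "f \<le> N" "t \<le> K" "u < 2"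
      by (auto simp: S_def valid_out_pair valid_in_pair less_Suc_eq_le)
    have "eta (p a x) = hidden_mix \<epsilon> K u t * eta (flag \<epsilon> N f) + flag \<epsilon> N f * eta (hidden_mix \<epsilon> K u t)"
      using ax e NK by (simp add: val eta_mult fl hidden_mix_bounds)
    moreover have "flag \<epsilon> N f * ?c t \<le> flag \<epsilon> N f * eta (hidden_mix \<epsilon> K u t)"
      using hm[OF ax(5)] fl by (intro mult_left_mono)
    moreover have "?q a x = hidden_mix \<epsilon> K u t * eta (flag \<epsilon> N f) + flag \<epsilon> N f * ?c t"
      using ax by simp
    ultimately show "?q a x \<le> eta (p a x)" by linarith
  qed
  then show "flag_entropy \<epsilon> N + \<epsilon> * log 2 (real K) \<le> meas_entropy S p"
    using weight by simp
qed

section \<open>The crossed state and its entropies\<close>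

declare One_nat_def [simp del]

text \<open>A local component of the mixture \<open>crossed\<close>: the own flag \<open>s\<close>
  is certain, while the good input \<open>b\<close> will be set by the flag of the other
  side.\<close>

definition tagged :: "nat \<Rightarrow> nat \<Rightarrow> nat \<Rightarrow> nat \<Rightarrow> bstate" where
  "tagged N K s b = product_state [(1, Suc N)] (single_box 1 (Suc N) (\<lambda>_ t. of_bool (t = s)))
     (single_box 2 (Suc K) (hidden K b))"

lemma tagged_apply:
  "f \<le> N \<Longrightarrow> t \<le> K \<Longrightarrow> u < 2 \<Longrightarrow> tagged N K s b [f, t] [0, u] = of_bool (f = s) * hidden K b u t"
  by (simp add: tagged_def)

lemma is_boxsys_tagged: "is_boxsys [(1, Suc N), (2, Suc K)]"
  by (auto simp: is_boxsys_def less_Suc_eq)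

lemma is_state_tagged:
  assumes "0 < K" "s \<le> N"
  shows "is_state [(1, Suc N), (2, Suc K)] (tagged N K s b)"
proof -
  have s: "(\<Sum>t<Suc N. of_bool (t = s)) = (1::real)"
    using assms(2) by (simp add: of_bool_def less_Suc_eq_le del: sum.lessThan_Suc)
  have "state_cone [(1, Suc N), (2, Suc K)] (tagged N K s b)"
    unfolding tagged_def
    by (intro state_cone_product_state_Cons; rule state_cone_single_box)
      (use assms s in \<open>simp_all add: hidden_bounds sum_hidden del: sum.lessThan_Suc\<close>)
  moreover have "weight [(1, Suc N), (2, Suc K)] (tagged N K s b) = 1"
    unfolding tagged_def weight_product_state_Cons
    using assms s by (simp add: weight_single_box sum_hidden del: sum.lessThan_Suc)
  ultimately show ?thesis by (simp add: is_state_iff[OF is_boxsys_tagged])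
qed

text \<open>The flags \<open>f\<close>, \<open>g\<close> are outputs of the first boxes of \<open>X\<close> and \<open>Y\<close>; each of them
  tells the good input of the hidden box on the other side.\<close>

definition crossed :: "nat \<Rightarrow> nat \<Rightarrow> nat \<Rightarrow> nat \<Rightarrow> (nat \<Rightarrow> nat \<Rightarrow> real) \<Rightarrow> bstate" where
  "crossed N K N' K' w = (\<lambda>a x. \<Sum>(f, g)\<in>{..<Suc N} \<times> {..<Suc N'}. w f g *
     product_state [(1, Suc N), (2, Suc K)]
       (tagged N K f (of_bool (g \<noteq> 0))) (tagged N' K' g (of_bool (f \<noteq> 0))) a x)"

abbreviation crossed_sys :: "nat \<Rightarrow> nat \<Rightarrow> nat \<Rightarrow> nat \<Rightarrow> boxsys" where
  "crossed_sys N K N' K' \<equiv> [(1, Suc N), (2, Suc K), (1, Suc N'), (2, Suc K')]"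

lemma crossed_apply:
  assumes "f \<le> N" "t \<le> K" "g \<le> N'" "t' \<le> K'" "u < 2" "u' < 2"
  shows "crossed N K N' K' w [f, t, g, t'] [0, u, 0, u']
    = w f g * (hidden K (of_bool (g \<noteq> 0)) u t * hidden K' (of_bool (f \<noteq> 0)) u' t')"
proof -
  let ?h = "hidden K (of_bool (g \<noteq> 0)) u t * hidden K' (of_bool (f \<noteq> 0)) u' t'"
  have "crossed N K N' K' w [f, t, g, t'] [0, u, 0, u']
      = (\<Sum>k\<in>{..<Suc N} \<times> {..<Suc N'}. if k = (f, g) then w f g * ?h else 0)"
    unfolding crossed_def
    using assms by (intro sum.cong refl) (auto simp: product_state_def tagged_apply)
  then show ?thesis
    using assms by simp
qed

text \<open>The weights \<open>w\<close> are kept general: products of flag probabilities give the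
  state, and \<open>eta\<close> of these products gives the certificate for the joint lower
  bound.\<close>

lemma state_cone_crossed:
  assumes "0 < K" "0 < K'" "\<And>f g. f \<le> N \<Longrightarrow> g \<le> N' \<Longrightarrow> 0 \<le> w f g"
  shows "state_cone (crossed_sys N K N' K') (crossed N K N' K' w)"
proof -
  have "state_cone ([(1, Suc N), (2, Suc K)] @ [(1, Suc N'), (2, Suc K')]) (crossed N K N' K' w)"
    unfolding crossed_def case_prod_unfold
  proof (intro state_cone_sum state_cone_scale state_cone_product_state)
    fix k assume "k \<in> {..<Suc N} \<times> {..<Suc N'}"
    then have k: "fst k \<le> N" "snd k \<le> N'" by auto
    show "state_cone [(1, Suc N), (2, Suc K)] (tagged N K (fst k) (of_bool (snd k \<noteq> 0)))"
      "state_cone [(1, Suc N'), (2, Suc K')] (tagged N' K' (snd k) (of_bool (fst k \<noteq> 0)))"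
      using is_state_tagged[OF assms(1) k(1)] is_state_tagged[OF assms(2) k(2)]
      by (simp_all add: is_state_altdef)
    show "0 \<le> w (fst k) (snd k)" using assms(3) k by simp
  qed
  then show ?thesis by simp
qed

lemma weight_crossed:
  assumes "0 < K" "0 < K'"
  shows "weight (crossed_sys N K N' K') (crossed N K N' K' w) = (\<Sum>f<Suc N. \<Sum>g<Suc N'. w f g)"
proof -
  have "weight ([(1, Suc N), (2, Suc K)] @ [(1, Suc N'), (2, Suc K')]) (crossed N K N' K' w)
      = (\<Sum>k\<in>{..<Suc N} \<times> {..<Suc N'}. w (fst k) (snd k))"
    unfolding crossed_def case_prod_unfold weight_sum weight_scale weight_product_state
    using is_state_tagged[OF assms(1)] is_state_tagged[OF assms(2)]
    by (intro sum.cong refl) (auto simp: is_state_iff[OF is_boxsys_tagged])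
  then show ?thesis
    by (simp add: sum.cartesian_product case_prod_unfold del: sum.lessThan_Suc)
qed

lemma is_boxsys_crossed: "is_boxsys (crossed_sys N K N' K')"
  using is_boxsys_append[of "[(1, Suc N), (2, Suc K)]" "[(1, Suc N'), (2, Suc K')]"]
  by (simp add: is_boxsys_tagged)

text \<open>Each hidden box gets the input announced by the flag of the other side. The flag boxes
  have a single input, so both flags can be read first; formally, no-signalling resets the two
  hidden inputs to 0 in turn.\<close>

lemma fiducial_measurement_adaptive:
  "fiducial_measurement (crossed_sys N K N' K') (outs (crossed_sys N K N' K')) (\<lambda>_. 1) (\<lambda>a. a)
     (\<lambda>a. [0, of_bool (a ! 2 \<noteq> 0), 0, of_bool (a ! 0 \<noteq> 0)])"
  unfolding fiducial_measurement_def
proof (intro conjI allI impI ballI)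
  let ?S = "crossed_sys N K N' K'"
  show "finite (outs ?S)" by simp
  show "valid_out ?S a" if "a \<in> outs ?S" for a using that by (simp add: outs_def)
  have vin: "valid_in ?S [0, u, 0, u']" if "u < 2" "u' < 2" for u u'
    using that by (simp add: valid_in_list_all2)
  show "valid_in ?S [0, of_bool (a ! 2 \<noteq> 0), 0, of_bool (a ! 0 \<noteq> 0)]" for a
    by (intro vin) auto
  fix p assume p: "is_state ?S p"
  then have ns: "no_signalling ?S p" by (simp add: is_state_altdef state_cone_def)
  have last: "(\<Sum>t'<Suc K'. p [f, t, g, t'] [0, u, 0, u']) = (\<Sum>t'<Suc K'. p [f, t, g, t'] [0, u, 0, 0])"
    if "f < Suc N" "t < Suc K" "g < Suc N'" "u < 2" "u' < 2" for f t g u u'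
  proof -
    have "(\<Sum>r<snd (?S ! 3). p ([f, t, g, 0][3 := r]) [0, u, 0, u'])
        = (\<Sum>r<snd (?S ! 3). p ([f, t, g, 0][3 := r]) [0, u, 0, 0])"
    proof (rule no_signallingD[OF ns])
      show "valid_out ?S [f, t, g, 0]"
        using that by (simp add: valid_out_list_all2)
      show "\<forall>j<length ?S. j \<noteq> 3 \<longrightarrow> [0, u, 0, u'] ! j = [0, u, 0, 0] ! j"
        by (auto simp: less_Suc_eq numeral_3_eq_3)
    qed (use that in \<open>simp_all add: vin\<close>)
    then show ?thesis
      by (simp add: numeral_3_eq_3 del: sum.lessThan_Suc)
  qed
  have second: "(\<Sum>t<Suc K. p [f, t, g, t'] [0, u, 0, 0]) = (\<Sum>t<Suc K. p [f, t, g, t'] [0, 0, 0, 0])"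
    if "f < Suc N" "g < Suc N'" "t' < Suc K'" "u < 2" for f g t' u
  proof -
    have "(\<Sum>r<snd (?S ! Suc 0). p ([f, 0, g, t'][Suc 0 := r]) [0, u, 0, 0])
        = (\<Sum>r<snd (?S ! Suc 0). p ([f, 0, g, t'][Suc 0 := r]) [0, 0, 0, 0])"
    proof (rule no_signallingD[OF ns])
      show "valid_out ?S [f, 0, g, t']"
        using that by (simp add: valid_out_list_all2)
      show "\<forall>j<length ?S. j \<noteq> Suc 0 \<longrightarrow> [0, u, 0, 0] ! j = [0, 0, 0, 0] ! j"
        by (auto simp: less_Suc_eq)
    qed (use that in \<open>simp_all add: vin\<close>)
    then show ?thesis
      by (simp del: sum.lessThan_Suc)
  qed
  have "(\<Sum>a\<in>outs ?S. 1 * p a [0, of_bool (a ! 2 \<noteq> 0), 0, of_bool (a ! 0 \<noteq> 0)])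
      = (\<Sum>f<Suc N. \<Sum>t<Suc K. \<Sum>g<Suc N'. \<Sum>t'<Suc K'.
          p [f, t, g, t'] [0, of_bool (g \<noteq> 0), 0, of_bool (f \<noteq> 0)])"
    by (simp add: sum_outs_Cons outs_Nil numeral_2_eq_2 del: sum.lessThan_Suc)
  \<comment> \<open>The innermost sum runs over the last output, so the input of that box can be
    reset.\<close>
  also have "\<dots> = (\<Sum>f<Suc N. \<Sum>t<Suc K. \<Sum>g<Suc N'. \<Sum>t'<Suc K'.
          p [f, t, g, t'] [0, of_bool (g \<noteq> 0), 0, 0])"
    by (intro sum.cong refl last) auto
  \<comment> \<open>The index \<open>t\<close> has to be innermost before the other hidden box can
    be reset.\<close>
  also have "\<dots> = (\<Sum>f<Suc N. \<Sum>g<Suc N'. \<Sum>t'<Suc K'. \<Sum>t<Suc K.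
          p [f, t, g, t'] [0, of_bool (g \<noteq> 0), 0, 0])"
    by (subst (2) sum.swap, subst (3) sum.swap) (rule refl)
  also have "\<dots> = (\<Sum>f<Suc N. \<Sum>g<Suc N'. \<Sum>t'<Suc K'. \<Sum>t<Suc K. p [f, t, g, t'] [0, 0, 0, 0])"
    by (intro sum.cong refl second) auto
  also have "\<dots> = (\<Sum>f<Suc N. \<Sum>t<Suc K. \<Sum>g<Suc N'. \<Sum>t'<Suc K'. p [f, t, g, t'] [0, 0, 0, 0])"
    by (subst (3) sum.swap, subst (2) sum.swap) (rule refl)
  also have "\<dots> = (\<Sum>a\<in>outs ?S. p a [0, 0, 0, 0])"
    by (simp add: sum_outs_Cons outs_Nil del: sum.lessThan_Suc)
  also have "\<dots> = 1"
    using p vin[of 0 0] by (simp add: is_state_altdef)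
  finally show "(\<Sum>a\<in>outs ?S. 1 * p a [0, of_bool (a ! 2 \<noteq> 0), 0, of_bool (a ! 0 \<noteq> 0)]) = 1" .
qed simp_all

text \<open>Jointly, adaptive inputs make the hidden outcomes certain, so that only the flags count,
  and a certificate matches this bound. Locally, averaging over the other side's flag leaves
  \<open>flag\<close> times \<open>hidden_mix\<close>.\<close>

lemma crossed_entropies:
  fixes \<epsilon> :: real and N K N' K' :: nat
  defines "p \<equiv> crossed N K N' K' (\<lambda>f g. flag \<epsilon> N f * flag \<epsilon> N' g)"
    and "SX \<equiv> [(1, Suc N), (2, Suc K)]" and "SY \<equiv> [(1, Suc N'), (2, Suc K')]"
  assumes e: "0 < \<epsilon>" "\<epsilon> \<le> 1/2" and pos: "0 < N" "0 < K" "0 < N'" "0 < K'"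
  shows "separable SX SY p"
    and "meas_entropy (SX @ SY) p = flag_entropy \<epsilon> N + flag_entropy \<epsilon> N'"
    and "flag_entropy \<epsilon> N + \<epsilon> * log 2 (real K) \<le> meas_entropy SX (marg_X SX SY p)"
    and "meas_entropy SX (marg_X SX SY p) \<le> flag_entropy \<epsilon> N + flag_entropy \<epsilon> K"
    and "flag_entropy \<epsilon> N' + \<epsilon> * log 2 (real K') \<le> meas_entropy SY (marg_Y SX SY p)"
    and "meas_entropy SY (marg_Y SX SY p) \<le> flag_entropy \<epsilon> N' + flag_entropy \<epsilon> K'"
proof -
  let ?S = "crossed_sys N K N' K'"
  have S: "SX @ SY = ?S" by (simp add: SX_def SY_def)
  have box: "is_boxsys SX" "is_boxsys SY" "is_boxsys ?S"
    by (simp_all add: SX_def SY_def is_boxsys_tagged is_boxsys_crossed)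
  have fl: "0 \<le> flag \<epsilon> M t" "flag \<epsilon> M t \<le> 1" for t M
    using e by (auto simp: flag_def field_simps divide_le_eq)
  have fl2: "0 \<le> flag \<epsilon> N f * flag \<epsilon> N' g" "flag \<epsilon> N f * flag \<epsilon> N' g \<le> 1" for f g
    using fl by (simp_all add: mult_le_one)
  have total: "(\<Sum>f<Suc N. \<Sum>g<Suc N'. flag \<epsilon> N f * flag \<epsilon> N' g) = 1"
    using pos by (simp add: sum_flag_1 del: sum.lessThan_Suc flip: sum_distrib_left)
  have p: "is_state ?S p"
    unfolding is_state_iff[OF box(3)] p_def weight_crossed[OF pos(2,4)]
    using pos fl2 total by (simp add: state_cone_crossed del: sum.lessThan_Suc)

  \<comment> \<open>\<open>separable\<close> indexes its mixture by \<open>i < n\<close>, so the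
    pairs of flags are enumerated.\<close>
  obtain h where h: "bij_betw h {..<card ({..<Suc N} \<times> {..<Suc N'})} ({..<Suc N} \<times> {..<Suc N'})"
    using ex_bij_betw_nat_finite[of "{..<Suc N} \<times> {..<Suc N'}"] by (auto simp: atLeast0LessThan)
  let ?n = "card ({..<Suc N} \<times> {..<Suc N'})"
  have hmem: "fst (h i) \<le> N \<and> snd (h i) \<le> N'" if "i < ?n" for i
    using bij_betwE[OF h] that by (metis SigmaE fst_conv snd_conv lessThan_iff less_Suc_eq_le)
  have reindex: "(\<Sum>i<?n. F (fst (h i)) (snd (h i))) = (\<Sum>(f, g)\<in>{..<Suc N} \<times> {..<Suc N'}. F f g)" for F :: "nat \<Rightarrow> nat \<Rightarrow> real"
    using sum.reindex_bij_betw[OF h, of "\<lambda>k. F (fst k) (snd k)"] by (simp add: case_prod_unfold)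
  show "separable SX SY p"
    unfolding separable_def
  proof (intro conjI exI allI impI)
    show "is_state (SX @ SY) p" using p S by simp
    fix i assume "i < ?n"
    then show "is_state SX (tagged N K (fst (h i)) (of_bool (snd (h i) \<noteq> 0)))"
      "is_state SY (tagged N' K' (snd (h i)) (of_bool (fst (h i) \<noteq> 0)))"
      using hmem pos by (simp_all add: SX_def SY_def is_state_tagged)
    show "0 \<le> flag \<epsilon> N (fst (h i)) * flag \<epsilon> N' (snd (h i))" by (rule fl2)
  next
    show "(\<Sum>i<?n. flag \<epsilon> N (fst (h i)) * flag \<epsilon> N' (snd (h i))) = 1"
      unfolding reindex[of "\<lambda>f g. flag \<epsilon> N f * flag \<epsilon> N' g"] sum.cartesian_product[symmetric] by (rule total)
    fix a b x y
    assume v: "valid_out SX a" "valid_out SY b" "valid_in SX x" "valid_in SY y"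
    then have "length a = length SX" "length x = length SX"
      by (simp_all add: valid_out_def valid_in_def)
    then show "p (a @ b) (x @ y) = (\<Sum>i<?n. flag \<epsilon> N (fst (h i)) * flag \<epsilon> N' (snd (h i)) *
        tagged N K (fst (h i)) (of_bool (snd (h i) \<noteq> 0)) a x *
        tagged N' K' (snd (h i)) (of_bool (fst (h i) \<noteq> 0)) b y)"
      unfolding reindex[of "\<lambda>f g. flag \<epsilon> N f * flag \<epsilon> N' g * tagged N K f (of_bool (g \<noteq> 0)) a x *
        tagged N' K' g (of_bool (f \<noteq> 0)) b y"]
      by (simp add: p_def crossed_def product_state_append mult.assoc flip: SX_def)
  qed

  have tot_eta: "(\<Sum>f<Suc N. \<Sum>g<Suc N'. eta (flag \<epsilon> N f * flag \<epsilon> N' g)) = flag_entropy \<epsilon> N + flag_entropy \<epsilon> N'"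
    using e pos by (subst sum_eta_mult) (simp_all add: fl sum_flag_1 sum_eta_flag del: sum.lessThan_Suc)
  have "meas_entropy ?S p \<le> (\<Sum>a\<in>outs ?S. eta (1 * p a [0, of_bool (a ! 2 \<noteq> 0), 0, of_bool (a ! 0 \<noteq> 0)]))"
    by (rule meas_entropy_le[OF box(3) fiducial_measurement_adaptive p])
  also have "\<dots> = (\<Sum>f<Suc N. \<Sum>t<Suc K. \<Sum>g<Suc N'. \<Sum>t'<Suc K'.
      eta (p [f, t, g, t'] [0, of_bool (g \<noteq> 0), 0, of_bool (f \<noteq> 0)]))"
    by (simp add: sum_outs_Cons outs_Nil numeral_2_eq_2 del: sum.lessThan_Suc)
  \<comment> \<open>Both hidden boxes receive their good inputs, so only the outcomes
    \<open>t = t' = 0\<close> occur.\<close>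
  also have "\<dots> = (\<Sum>f<Suc N. \<Sum>t<Suc K. \<Sum>g<Suc N'. \<Sum>t'<Suc K'.
      if t' = 0 then if t = 0 then eta (flag \<epsilon> N f * flag \<epsilon> N' g) else 0 else 0)"
    by (intro sum.cong refl) (simp add: p_def crossed_apply hidden_def less_Suc_eq_le)
  also have "\<dots> = (\<Sum>f<Suc N. \<Sum>t<Suc K. \<Sum>g<Suc N'. if t = 0 then eta (flag \<epsilon> N f * flag \<epsilon> N' g) else 0)"
    by (simp del: sum.lessThan_Suc)
  also have "\<dots> = (\<Sum>f<Suc N. \<Sum>g<Suc N'. \<Sum>t<Suc K. if t = 0 then eta (flag \<epsilon> N f * flag \<epsilon> N' g) else 0)"
    by (subst (2) sum.swap) (rule refl)
  also have "\<dots> = flag_entropy \<epsilon> N + flag_entropy \<epsilon> N'"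
    using tot_eta by (simp del: sum.lessThan_Suc)
  finally have upper: "meas_entropy ?S p \<le> flag_entropy \<epsilon> N + flag_entropy \<epsilon> N'" .

  \<comment> \<open>For \<open>?h\<close> between 0 and 1, \<open>eta_mult\<close> gives
    \<open>eta (?h * w) \<ge> ?h * eta w\<close>. Replacing the weights by their \<open>eta\<close>
    values is thus a certificate, and its weight is the entropy of the two flags.\<close>
  let ?q = "crossed N K N' K' (\<lambda>f g. eta (flag \<epsilon> N f * flag \<epsilon> N' g))"
  have "weight ?S ?q \<le> meas_entropy ?S p"
  proof (rule meas_entropy_ge_weight[OF box(3) p])
    show "state_cone ?S ?q"
      using pos fl2 by (intro state_cone_crossed) (simp_all add: eta_nonneg)
    fix a x assume "valid_out ?S a" "valid_in ?S x"
    then obtain f t g t' u u' where ax: "a = [f, t, g, t']" "x = [0, u, 0, u']"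
      "f \<le> N" "t \<le> K" "g \<le> N'" "t' \<le> K'" "u < 2" "u' < 2"
      by (auto simp: valid_out_list_all2 valid_in_list_all2 list_all2_Cons1 less_Suc_eq_le)
    let ?h = "hidden K (of_bool (g \<noteq> 0)) u t * hidden K' (of_bool (f \<noteq> 0)) u' t'"
    have h: "0 \<le> ?h" "?h \<le> 1"
      using hidden_bounds[OF pos(2)] hidden_bounds[OF pos(4)] by (simp_all add: mult_le_one)
    have "eta (p a x) = ?h * eta (flag \<epsilon> N f * flag \<epsilon> N' g) + (flag \<epsilon> N f * flag \<epsilon> N' g) * eta ?h"
      using ax h fl2 by (simp add: p_def crossed_apply eta_mult del: mult_eq_0_iff)
    moreover have "0 \<le> (flag \<epsilon> N f * flag \<epsilon> N' g) * eta ?h"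
      using fl2(1) eta_nonneg[OF h] by (rule mult_nonneg_nonneg)
    ultimately show "?q a x \<le> eta (p a x)"
      using ax by (simp add: crossed_apply mult.commute)
  qed
  then show "meas_entropy (SX @ SY) p = flag_entropy \<epsilon> N + flag_entropy \<epsilon> N'"
    using upper tot_eta unfolding S weight_crossed[OF pos(2,4)] by simp

  \<comment> \<open>The hidden box on the other side depends on a flag only through whether it is
    nonzero.\<close>
  have sum_flag: "(\<Sum>t<Suc M. flag \<epsilon> M t * F (of_bool (t \<noteq> 0))) = (1 - \<epsilon>) * F 0 + \<epsilon> * F 1"
    if "0 < M" for M and F :: "nat \<Rightarrow> real"
    unfolding sum.lessThan_Suc_shift using that by (simp add: flag_def)
  have pX: "is_state SX (marg_X SX SY p)" and pY: "is_state SY (marg_Y SX SY p)"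
    using is_state_marg_X is_state_marg_Y box p by (simp_all add: S)
  have mX: "marg_X SX SY p [f, t] [0, u] = flag \<epsilon> N f * hidden_mix \<epsilon> K u t"
    if "f \<le> N" "t \<le> K" "u < 2" for f t u
  proof -
    have "marg_X SX SY p [f, t] [0, u] = (\<Sum>g<Suc N'. \<Sum>t'<Suc K'. p [f, t, g, t'] [0, u, 0, 0])"
      using that by (simp add: marg_X_def SX_def SY_def valid_out_pair valid_in_pair
          sum_outs_Cons outs_Nil numeral_2_eq_2 less_Suc_eq_le del: sum.lessThan_Suc)
    also have "\<dots> = (\<Sum>g<Suc N'. \<Sum>t'<Suc K'. flag \<epsilon> N f * (flag \<epsilon> N' g * hidden K (of_bool (g \<noteq> 0)) u t)
        * hidden K' (of_bool (f \<noteq> 0)) 0 t')"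
      using that by (intro sum.cong refl) (simp add: p_def crossed_apply less_Suc_eq_le)
    also have "\<dots> = flag \<epsilon> N f * (\<Sum>g<Suc N'. flag \<epsilon> N' g * hidden K (of_bool (g \<noteq> 0)) u t)"
      using pos by (simp add: sum_hidden del: sum.lessThan_Suc flip: sum_distrib_left)
    also have "\<dots> = flag \<epsilon> N f * hidden_mix \<epsilon> K u t"
      by (subst sum_flag[OF pos(3), of "\<lambda>b. hidden K b u t"]) (simp add: hidden_mix_def)
    finally show ?thesis .
  qed
  have mY: "marg_Y SX SY p [g, t'] [0, u'] = flag \<epsilon> N' g * hidden_mix \<epsilon> K' u' t'"
    if "g \<le> N'" "t' \<le> K'" "u' < 2" for g t' u'
  proof -
    have "marg_Y SX SY p [g, t'] [0, u'] = (\<Sum>f<Suc N. \<Sum>t<Suc K. p [f, t, g, t'] [0, 0, 0, u'])"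
      using that by (simp add: marg_Y_def SX_def SY_def valid_out_pair valid_in_pair
          sum_outs_Cons outs_Nil numeral_2_eq_2 less_Suc_eq_le del: sum.lessThan_Suc)
    also have "\<dots> = (\<Sum>f<Suc N. \<Sum>t<Suc K. flag \<epsilon> N' g * (flag \<epsilon> N f * hidden K' (of_bool (f \<noteq> 0)) u' t')
        * hidden K (of_bool (g \<noteq> 0)) 0 t)"
      using that by (intro sum.cong refl) (simp add: p_def crossed_apply less_Suc_eq_le)
    also have "\<dots> = flag \<epsilon> N' g * (\<Sum>f<Suc N. flag \<epsilon> N f * hidden K' (of_bool (f \<noteq> 0)) u' t')"
      using pos by (simp add: sum_hidden del: sum.lessThan_Suc flip: sum_distrib_left)
    also have "\<dots> = flag \<epsilon> N' g * hidden_mix \<epsilon> K' u' t'"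
      by (subst sum_flag[OF pos(1), of "\<lambda>b. hidden K' b u' t'"]) (simp add: hidden_mix_def)
    finally show ?thesis .
  qed
  show "flag_entropy \<epsilon> N + \<epsilon> * log 2 (real K) \<le> meas_entropy SX (marg_X SX SY p)"
    "meas_entropy SX (marg_X SX SY p) \<le> flag_entropy \<epsilon> N + flag_entropy \<epsilon> K"
    using meas_entropy_flag_hidden[OF e pos(1,2) pX[unfolded SX_def] mX[unfolded SX_def]]
    by (simp_all add: SX_def)
  show "flag_entropy \<epsilon> N' + \<epsilon> * log 2 (real K') \<le> meas_entropy SY (marg_Y SX SY p)"
    "meas_entropy SY (marg_Y SX SY p) \<le> flag_entropy \<epsilon> N' + flag_entropy \<epsilon> K'"
    using meas_entropy_flag_hidden[OF e pos(3,4) pY[unfolded SY_def] mY[unfolded SY_def]]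
    by (simp_all add: SY_def)
qed

section \<open>The closure\<close>

text \<open>With \<epsilon> = \<open>1 / (n + 2)\<close> and \<open>K = 2 ^ k\<close>, where
  \<open>k\<close> is this floor, the ratio is \<epsilon> times the binary logarithm of
  \<open>K\<close>.\<close>

lemma floor_ratio_tendsto:
  fixes a :: real
  assumes "0 \<le> a"
  shows "(\<lambda>n. real (nat \<lfloor>real (n + 2) * a\<rfloor>) / real (n + 2)) \<longlonglongrightarrow> a"
proof (rule tendsto_sandwich[OF always_eventually always_eventually])
  show "\<forall>n. a - 1 / real (n + 2) \<le> real (nat \<lfloor>real (n + 2) * a\<rfloor>) / real (n + 2)"
  proof
    fix n :: nat
    have "real (n + 2) * a - 1 \<le> real (nat \<lfloor>real (n + 2) * a\<rfloor>)"
      using assms by linarith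
    then have "(real (n + 2) * a - 1) / real (n + 2) \<le> real (nat \<lfloor>real (n + 2) * a\<rfloor>) / real (n + 2)"
      by (rule divide_right_mono) simp
    then show "a - 1 / real (n + 2) \<le> real (nat \<lfloor>real (n + 2) * a\<rfloor>) / real (n + 2)"
      by (simp add: diff_divide_distrib)
  qed
  show "\<forall>n. real (nat \<lfloor>real (n + 2) * a\<rfloor>) / real (n + 2) \<le> a"
  proof
    fix n :: nat
    have "real (nat \<lfloor>real (n + 2) * a\<rfloor>) \<le> real (n + 2) * a"
      using assms by (simp add: of_nat_nat)
    then show "real (nat \<lfloor>real (n + 2) * a\<rfloor>) / real (n + 2) \<le> a"
      by (simp add: divide_le_eq mult.commute)
  qed
  have "(\<lambda>n. 1 / real (n + 2)) \<longlonglongrightarrow> 0"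
    by (rule LIMSEQ_ignore_initial_segment[OF lim_1_over_n])
  then show "(\<lambda>n. a - 1 / real (n + 2)) \<longlonglongrightarrow> a"
    using tendsto_diff[OF tendsto_const, of _ 0 sequentially a] by simp
qed simp

text \<open>The binary entropy of \<epsilon> is the only gap between the local bounds, so its
  vanishing makes them meet in the limit.\<close>

lemma binary_eta_tendsto_0:
  "(\<lambda>n. eta (1 - 1 / real (n + 2)) + eta (1 / real (n + 2))) \<longlonglongrightarrow> 0"
proof -
  have inv: "(\<lambda>n. 1 / real (n + 2)) \<longlonglongrightarrow> 0"
    by (rule LIMSEQ_ignore_initial_segment[OF lim_1_over_n])
  have "(\<lambda>n. eta (1 - 1 / real (n + 2))) \<longlonglongrightarrow> - (1 - 0) * log 2 (1 - 0)"
    unfolding eta_def by (intro tendsto_intros inv) auto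
  moreover have "(\<lambda>n. eta (1 / real (n + 2))) \<longlonglongrightarrow> 0"
  proof -
    have "(\<lambda>n. ln (real (n + 2)) / real (n + 2) / ln 2) \<longlonglongrightarrow> 0 / ln 2"
      by (intro tendsto_divide tendsto_const LIMSEQ_ignore_initial_segment[OF lim_ln_over_n]) simp
    moreover have "eta (1 / real (n + 2)) = ln (real (n + 2)) / real (n + 2) / ln 2" for n
      by (simp add: eta_def log_def ln_div)
    ultimately show ?thesis by simp
  qed
  ultimately show ?thesis
    using tendsto_add[of "\<lambda>n. eta (1 - 1 / real (n + 2))" 0 sequentially] by simp
qed

theorem theorem7:
  fixes SX SY :: boxsys and p :: bstate
  assumes "is_boxsys SX" and "is_boxsys SY" and "is_state (SX @ SY) p"
  shows "entropy_vec SX SY p \<in> closure separable_entropy_vecs"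
proof -
  define \<alpha> \<beta> \<gamma> where "\<alpha> = meas_entropy SX (marg_X SX SY p)"
    and "\<beta> = meas_entropy SY (marg_Y SX SY p)" and "\<gamma> = meas_entropy (SX @ SY) p"
  have nonneg: "0 \<le> \<alpha>" "0 \<le> \<beta>" "0 \<le> \<gamma>" and sub: "\<gamma> \<le> \<alpha> + \<beta>"
    using assms is_state_marg_X[OF assms] is_state_marg_Y[OF assms]
    by (simp_all add: \<alpha>_def \<beta>_def \<gamma>_def meas_entropy_nonneg meas_entropy_subadditive is_boxsys_append)
  \<comment> \<open>As much of \<gamma> as fits is assigned to the flag of \<open>X\<close>; the
    rest is at most \<beta> by subadditivity.\<close>
  define s where "s = min \<alpha> \<gamma>"
  define t where "t = \<gamma> - s"
  have st: "0 \<le> s" "0 \<le> \<alpha> - s" "0 \<le> t" "0 \<le> \<beta> - t" "s + t = \<gamma>"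
    using nonneg sub by (auto simp: s_def t_def)
  \<comment> \<open>The shift by 2 keeps \<open>e n\<close> at most 1/2 for every
    \<open>n\<close>.\<close>
  define e where "e n = 1 / real (n + 2)" for n
  define k where "k a n = nat \<lfloor>real (n + 2) * a\<rfloor>" for a and n
  \<comment> \<open>A power of 2 is positive, and its logarithm times \<open>e n\<close> is the
    floor ratio, which tends to \<open>a\<close>.\<close>
  define K :: "real \<Rightarrow> nat \<Rightarrow> nat" where "K a n = 2 ^ k a n" for a n
  define h where "h n = eta (1 - e n) + eta (e n)" for n
  have e: "0 < e n" "e n \<le> 1/2" for n
    by (auto simp: e_def field_simps)
  have K: "0 < K a n" for a n by (simp add: K_def)
  have logK: "e n * log 2 (real (K a n)) = real (k a n) / real (n + 2)" for a n
    by (simp add: K_def e_def log_nat_power)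
  have lim_k: "(\<lambda>n. real (k a n) / real (n + 2)) \<longlonglongrightarrow> a" if "0 \<le> a" for a
    using floor_ratio_tendsto[OF that] by (simp add: k_def)
  have lim_h: "h \<longlonglongrightarrow> 0"
    unfolding h_def[abs_def] e_def by (rule binary_eta_tendsto_0)
  have flag: "flag_entropy (e n) (K a n) = h n + real (k a n) / real (n + 2)" for a n
    by (simp add: flag_entropy_def h_def logK)
  have lim_flag: "(\<lambda>n. flag_entropy (e n) (K a n)) \<longlonglongrightarrow> a" if "0 \<le> a" for a
    using tendsto_add[OF lim_h lim_k[OF that]] by (simp add: flag)
  define X Y :: "nat \<Rightarrow> boxsys" where "X n = [(1, Suc (K s n)), (2, Suc (K (\<alpha> - s) n))]"
    and "Y n = [(1, Suc (K t n)), (2, Suc (K (\<beta> - t) n))]" for n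
  define q where "q n = crossed (K s n) (K (\<alpha> - s) n) (K t n) (K (\<beta> - t) n)
    (\<lambda>f g. flag (e n) (K s n) f * flag (e n) (K t n) g)" for n
  have ent: "separable (X n) (Y n) (q n)"
    "meas_entropy (X n @ Y n) (q n) = flag_entropy (e n) (K s n) + flag_entropy (e n) (K t n)"
    "flag_entropy (e n) (K s n) + e n * log 2 (real (K (\<alpha> - s) n))
      \<le> meas_entropy (X n) (marg_X (X n) (Y n) (q n))"
    "meas_entropy (X n) (marg_X (X n) (Y n) (q n))
      \<le> flag_entropy (e n) (K s n) + flag_entropy (e n) (K (\<alpha> - s) n)"
    "flag_entropy (e n) (K t n) + e n * log 2 (real (K (\<beta> - t) n))
      \<le> meas_entropy (Y n) (marg_Y (X n) (Y n) (q n))"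
    "meas_entropy (Y n) (marg_Y (X n) (Y n) (q n))
      \<le> flag_entropy (e n) (K t n) + flag_entropy (e n) (K (\<beta> - t) n)" for n
    unfolding q_def X_def Y_def by (rule crossed_entropies[OF e K K K K])+
  have mem: "entropy_vec (X n) (Y n) (q n) \<in> separable_entropy_vecs" for n
  proof -
    have "is_boxsys (X n)" "is_boxsys (Y n)"
      by (simp_all only: X_def Y_def is_boxsys_tagged)
    then show ?thesis
      unfolding separable_entropy_vecs_def using ent(1)[of n] by blast
  qed
  \<comment> \<open>The two bounds differ by \<open>h n\<close>, which tends to 0.\<close>
  have squeeze: "(\<lambda>n. H n) \<longlonglongrightarrow> a + b" if "0 \<le> a" "0 \<le> b"
    "\<And>n. flag_entropy (e n) (K a n) + e n * log 2 (real (K b n)) \<le> H n"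
    "\<And>n. H n \<le> flag_entropy (e n) (K a n) + flag_entropy (e n) (K b n)" for a b and H :: "nat \<Rightarrow> real"
    by (rule tendsto_sandwich[OF always_eventually always_eventually
          tendsto_add[OF lim_flag[OF that(1)] lim_k[OF that(2), folded logK]]
          tendsto_add[OF lim_flag[OF that(1)] lim_flag[OF that(2)]]])
      (use that(3,4) in auto)
  have "(\<lambda>n. entropy_vec (X n) (Y n) (q n)) \<longlonglongrightarrow> (\<alpha>, \<beta>, \<gamma>)"
    unfolding entropy_vec_def
  proof (intro tendsto_Pair)
    show "(\<lambda>n. meas_entropy (X n) (marg_X (X n) (Y n) (q n))) \<longlonglongrightarrow> \<alpha>"
      using squeeze[OF st(1,2) ent(3) ent(4)] by simp
    show "(\<lambda>n. meas_entropy (Y n) (marg_Y (X n) (Y n) (q n))) \<longlonglongrightarrow> \<beta>"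
      using squeeze[OF st(3,4) ent(5) ent(6)] by simp
    show "(\<lambda>n. meas_entropy (X n @ Y n) (q n)) \<longlonglongrightarrow> \<gamma>"
      unfolding ent(2) st(5)[symmetric] by (intro tendsto_add lim_flag st)
  qed
  then show ?thesis
    using mem unfolding closure_sequential
    by (intro exI[of _ "\<lambda>n. entropy_vec (X n) (Y n) (q n)"])
      (simp add: entropy_vec_def \<alpha>_def \<beta>_def \<gamma>_def)
qed

end
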